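(* Let $n\ge1$. The $W_t(j)$ coefficients for the $\mathfrak{so}(2n+1)$ spinorial quantum metric on $\mathcal{H}^{(n)}=(\mathbb{C}^2)^{\otimes n}$ are given by $$W_t(j)=\frac1{2^n}\sum_{s=0}^{2t}(-1)^s\binom{2j}s\binom{2n+1-2j}{2t-s}\qquad\text{for }0\le t,j\le n.$$
   Context: Spinorial quantum metric: with Pauli matrices $\sigma_x,\sigma_y,\sigma_z$, put $U_k=\sigma_z^{\otimes k-1}\otimes\sigma_x\otimes I_2^{\otimes n-k}$ and $U_{n+k}=\sigma_z^{\otimes k-1}\otimes\sigma_y\otimes I_2^{\otimes n-k}$ for $1\le k\le n$, and $U_{2n+1}=\sigma_z^{\otimes n}$ (Hermitian, unitary, pairwise anticommuting). Let $\mathcal{E}=\operatorname{span}(\{I\}\cup\{U_kU_l:1\le k<l\le2n+1\})$; the $\mathfrak{so}(2n+1)$ spinorial quantum metric is $\mathcal{E}_t=\mathbb{C}I$ for $0\le t<1$ and $\mathcal{E}_t=\mathcal{E}^{\lfloor t\rfloor}$ (span of products of $\lfloor t\rfloor$ elements of $\mathcal{E}$) for $t\ge1$. Its diameter (smallest $r$ with $\mathcal{E}_r=\mathcal{L}(\mathcal{H}^{(n)})$) is $r=n$. On $\mathcal{L}(\mathcal{H}^{(n)})$ use the Hilbert–Schmidt inner product $\operatorname{tr}(E^*F)$; put $\mathcal{V}_0=\mathbb{C}I$ and $\mathcal{V}_t=\mathcal{E}_t\cap\mathcal{E}_{t-1}^\perp$ for $1\le t\le n$. $W_t(j)$ coefficients: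 for $\mathcal{B}_t$ any orthonormal basis of $\mathcal{V}_t$, let $\Phi_t(X)=\sum_{E\in\mathcal{B}_t}EXE^*$ and let $\Pi_t(X)=\sum_{E\in\mathcal{B}_t}\operatorname{tr}(E^*X)E$ (the orthogonal projection onto $\mathcal{V}_t$), as linear maps on the self-adjoint operators. The coefficients $W_t(j)\in\mathbb{R}$ are the unique numbers with $\Phi_t=\sum_{j=0}^{r}W_t(j)\Pi_j$ for $0\le t\le r$; equivalently $\Phi_t(X)=W_t(j)X$ for $X\in\mathcal{V}_j$ (such numbers exist for this metric). *)

theory Defs
  imports "Jordan_Normal_Form.VS_Connect" "Jordan_Normal_Form.Schur_Decomposition"
begin

section \<open>Operators on a \<open>d\<close>-dimensional Hilbert space\<close>

text \<open>\<open>\<L>(\<complex>\<^sup>d)\<close> is \<open>carrier_mat d d\<close>, viewed as a complex vector space.\<close>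

abbreviation op_space :: "nat \<Rightarrow> (complex, complex mat) module" where
  "op_space d \<equiv> module_mat TYPE(complex) d d"

definition op_span :: "nat \<Rightarrow> complex mat set \<Rightarrow> complex mat set" where
  "op_span d S = LinearCombinations.module.span class_ring (op_space d) S"

definition mat_trace :: "complex mat \<Rightarrow> complex" where
  "mat_trace A = (\<Sum>i<dim_row A. A $$ (i, i))"

definition hs_inner :: "complex mat \<Rightarrow> complex mat \<Rightarrow> complex" where
  "hs_inner E F = mat_trace (mat_adjoint E * F)"

definition hs_orthogonal :: "nat \<Rightarrow> complex mat set \<Rightarrow> complex mat set" where
  "hs_orthogonal d S = {X \<in> carrier_mat d d. \<forall>Y\<in>S. hs_inner Y X = 0}"

definition hs_orthonormal_basis :: "nat \<Rightarrow> complex mat set \<Rightarrow> complex mat set \<Rightarrow> bool" where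
  "hs_orthonormal_basis d V B \<longleftrightarrow>
     finite B \<and> B \<subseteq> V \<and>
     (\<forall>E\<in>B. \<forall>F\<in>B. hs_inner E F = (if E = F then 1 else 0)) \<and>
     op_span d B = V"

definition self_adjoint_ops :: "nat \<Rightarrow> complex mat set" where
  "self_adjoint_ops d = {X \<in> carrier_mat d d. mat_adjoint X = X}"


section \<open>The coefficients \<open>W\<^sub>t(j)\<close> of a quantum metric\<close>

text \<open>A quantum metric is given as a family \<open>\<E> :: real \<Rightarrow> complex mat set\<close>, relevant only
  at nonnegative arguments.\<close>

definition qm_diameter :: "nat \<Rightarrow> (real \<Rightarrow> complex mat set) \<Rightarrow> real" where
  "qm_diameter d \<E> = (LEAST r. 0 \<le> r \<and> \<E> r = carrier_mat d d)"

definition qm_layer :: "nat \<Rightarrow> (real \<Rightarrow> complex mat set) \<Rightarrow> nat \<Rightarrow> complex mat set" where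
  "qm_layer d \<E> t =
     (if t = 0 then op_span d {1\<^sub>m d}
      else \<E> (real t) \<inter> hs_orthogonal d (\<E> (real t - 1)))"

definition Phi_map :: "nat \<Rightarrow> complex mat set \<Rightarrow> complex mat \<Rightarrow> complex mat" where
  "Phi_map d B X = (\<Oplus>\<^bsub>op_space d\<^esub>E\<in>B. E * X * mat_adjoint E)"

definition Pi_map :: "nat \<Rightarrow> complex mat set \<Rightarrow> complex mat \<Rightarrow> complex mat" where
  "Pi_map d B X = (\<Oplus>\<^bsub>op_space d\<^esub>E\<in>B. hs_inner E X \<cdot>\<^sub>m E)"

text \<open>The defining relation \<open>\<Phi>\<^sub>t = (\<Sum>j\<le>r. W\<^sub>t(j) \<Pi>\<^sub>j)\<close> for all \<open>t \<le> r\<close>, as maps on the self-adjoint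
  operators, for every choice of orthonormal bases \<open>B j\<close> of the layers.\<close>

definition is_W_family ::
  "nat \<Rightarrow> (real \<Rightarrow> complex mat set) \<Rightarrow> (nat \<Rightarrow> nat \<Rightarrow> real) \<Rightarrow> bool" where
  "is_W_family d \<E> W \<longleftrightarrow>
     (let r = nat \<lfloor>qm_diameter d \<E>\<rfloor> in
      \<forall>B. (\<forall>j\<le>r. hs_orthonormal_basis d (qm_layer d \<E> j) (B j)) \<longrightarrow>
        (\<forall>t\<le>r. \<forall>X\<in>self_adjoint_ops d.
           Phi_map d (B t) X =
             (\<Oplus>\<^bsub>op_space d\<^esub>j\<in>{0..r}. complex_of_real (W t j) \<cdot>\<^sub>m Pi_map d (B j) X)))"

text \<open>A family is only constrained at indices up to the diameter, so uniqueness is required of the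
  individual number at \<open>(t, j)\<close> rather than of the whole function. Evaluating \<open>W_coeff\<close> thus requires
  that a family exists and that any two families agree at \<open>(t, j)\<close>.\<close>

definition W_coeff :: "nat \<Rightarrow> (real \<Rightarrow> complex mat set) \<Rightarrow> nat \<Rightarrow> nat \<Rightarrow> real" where
  "W_coeff d \<E> t j = (THE w. \<exists>W. is_W_family d \<E> W \<and> W t j = w)"


section \<open>The \<open>\<s>\<o>(2n+1)\<close> spinorial quantum metric\<close>

definition kron :: "complex mat \<Rightarrow> complex mat \<Rightarrow> complex mat" (infixl \<open>\<otimes>\<^sub>K\<close> 70) where
  "A \<otimes>\<^sub>K B = mat (dim_row A * dim_row B) (dim_col A * dim_col B)
     (\<lambda>(i, j). A $$ (i div dim_row B, j div dim_col B) * B $$ (i mod dim_row B, j mod dim_col B))"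

fun kron_pow :: "complex mat \<Rightarrow> nat \<Rightarrow> complex mat" where
  "kron_pow A 0 = 1\<^sub>m 1"
| "kron_pow A (Suc k) = A \<otimes>\<^sub>K kron_pow A k"

definition sigma_x :: "complex mat" where
  "sigma_x = mat_of_rows_list 2 [[0, 1], [1, 0]]"

definition sigma_y :: "complex mat" where
  "sigma_y = mat_of_rows_list 2 [[0, - \<i>], [\<i>, 0]]"

definition sigma_z :: "complex mat" where
  "sigma_z = mat_of_rows_list 2 [[1, 0], [0, - 1]]"

text \<open>Only the indices \<open>1 \<le> k \<le> 2 * n + 1\<close> are meaningful.\<close>

definition spin_U :: "nat \<Rightarrow> nat \<Rightarrow> complex mat" where
  "spin_U n k =
     (if k \<le> n then kron_pow sigma_z (k - 1) \<otimes>\<^sub>K sigma_x \<otimes>\<^sub>K kron_pow (1\<^sub>m 2) (n - k)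
      else if k \<le> 2 * n then
        kron_pow sigma_z (k - n - 1) \<otimes>\<^sub>K sigma_y \<otimes>\<^sub>K kron_pow (1\<^sub>m 2) (n - (k - n))
      else kron_pow sigma_z n)"

definition spin_E :: "nat \<Rightarrow> complex mat set" where
  "spin_E n = op_span (2 ^ n)
     ({1\<^sub>m (2 ^ n)} \<union> {spin_U n k * spin_U n l | k l. 1 \<le> k \<and> k < l \<and> l \<le> 2 * n + 1})"

definition op_set_power :: "nat \<Rightarrow> complex mat set \<Rightarrow> nat \<Rightarrow> complex mat set" where
  "op_set_power d S m =
     op_span d {foldr (*) As (1\<^sub>m d) | As. length As = m \<and> set As \<subseteq> S}"

definition spin_metric :: "nat \<Rightarrow> real \<Rightarrow> complex mat set" where
  "spin_metric n t =
     (if t < 1 then op_span (2 ^ n) {1\<^sub>m (2 ^ n)}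
      else op_set_power (2 ^ n) (spin_E n) (nat \<lfloor>t\<rfloor>))"

end

theory Submission
  imports Defs
begin

text \<open>
  For a set \<open>S\<close> of generator indices let \<open>U\<^sub>S\<close> be the ordered product of the \<open>U\<^sub>k\<close> with \<open>k \<in> S\<close>.
  Up to sign the \<open>U\<^sub>S\<close> are closed under products, with symmetric difference on the index sets. If
  \<open>S\<close> is even and nonempty, \<open>U\<^sub>S\<close> anticommutes with \<open>U\<^sub>k\<close> for \<open>k \<in> S\<close>, so its trace vanishes. Hence
  the \<open>4\<^sup>n\<close> operators \<open>2\<^bsup>-n/2\<^esup> U\<^sub>S\<close> with \<open>S\<close> even form an orthonormal basis of all operators,
  \<open>\<E>\<^sub>t\<close> is spanned by those with \<open>|S| \<le> 2t\<close>, and \<open>\<V>\<^sub>t\<close> by those with \<open>|S| = 2t\<close>. Since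
  \<open>U\<^sub>T U\<^sub>S U\<^sub>T\<^sup>* = (-1)\<^bsup>|T \<inter> S|\<^esup> U\<^sub>S\<close>, each \<open>U\<^sub>S\<close> with \<open>|S| = 2j\<close> is an eigenvector of \<open>\<Phi>\<^sub>t\<close>, and
  sorting the sets \<open>T\<close> of size \<open>2t\<close> by \<open>s = |T \<inter> S|\<close> gives the eigenvalue.
\<close>

section \<open>Spans of operators\<close>

text \<open>Only even sets occur because the product of all \<open>2 * n + 1\<close> generators is a
  scalar multiple of the identity: up to a scalar, an odd \<open>S\<close> gives the same operator
  as its even complement. Completeness comes from counting: there are 4^n even sets, as many as the
  dimension of the operator space, and a square isometry is invertible. Signs from reordering
  products are kept as an unspecified \<epsilon> in {1, -1}, since spans do not see them. The one
  sign that matters is that of a conjugation, where the reordering signs cancel by unitarity. The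
  specification shapes the rest. \<open>W_coeff\<close> is a definite description over families that
  must work for every choice of orthonormal bases, so \<Phi> and \<Pi> have to be shown independent
  of the basis. The defining relation is tested on self-adjoint operators only, so uniqueness needs
  a nonzero self-adjoint operator in each layer: a monomial times 1 or i. The factor 1 / 2^n is the
  square of the normalisation 2^(-n/2).\<close>

lemma finsum_op_space_carrier:
  assumes "f \<in> A \<rightarrow> carrier_mat d d"
  shows "finsum (op_space d) f A \<in> carrier_mat d d"
proof -
  interpret matrix_vs d d "TYPE(complex)" .
  show ?thesis using finsum_closed[of f A] assms by simp
qed

lemma finsum_op_space_insert:
  assumes "finite A" "a \<notin> A" "f \<in> insert a A \<rightarrow> carrier_mat d d"
  shows "finsum (op_space d) f (insert a A) = f a + finsum (op_space d) f A"
proof -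
  interpret matrix_vs d d "TYPE(complex)" .
  show ?thesis using finsum_insert[of A a f] assms by auto
qed

lemma finsum_op_space_empty: "finsum (op_space d) f {} = 0\<^sub>m d d"
proof -
  interpret matrix_vs d d "TYPE(complex)" .
  show ?thesis using finsum_empty[of f] by simp
qed

lemma finsum_op_space_index:
  assumes "finite A" "f \<in> A \<rightarrow> carrier_mat d d" "p \<in> {..<d} \<times> {..<d}"
  shows "finsum (op_space d) f A $$ p = (\<Sum>a\<in>A. f a $$ p)"
  using assms(1,2)
proof (induction A)
  case empty
  then show ?case using assms(3) by (auto simp: finsum_op_space_empty)
next
  case (insert a A)
  then have "finsum (op_space d) f A \<in> carrier_mat d d"
    by (intro finsum_op_space_carrier) auto
  then show ?case
    using insert assms(3) by (auto simp: finsum_op_space_insert)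
qed

lemma op_span_submodule:
  assumes "S \<subseteq> carrier_mat d d"
  shows "submodule class_ring (op_span d S) (op_space d)"
proof -
  interpret matrix_vs d d "TYPE(complex)" .
  show ?thesis using span_is_submodule[of S] assms by (simp add: op_span_def)
qed

lemma op_span_closed:
  assumes "S \<subseteq> carrier_mat d d"
  shows op_span_zero: "0\<^sub>m d d \<in> op_span d S"
    and op_span_add: "\<lbrakk>X \<in> op_span d S; Y \<in> op_span d S\<rbrakk> \<Longrightarrow> X + Y \<in> op_span d S"
    and op_span_smult: "X \<in> op_span d S \<Longrightarrow> c \<cdot>\<^sub>m X \<in> op_span d S"
    and op_span_base: "X \<in> S \<Longrightarrow> X \<in> op_span d S"
    and op_span_carrier: "op_span d S \<subseteq> carrier_mat d d"
proof -
  interpret matrix_vs d d "TYPE(complex)" .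
  note sub = op_span_submodule[OF assms]
  show "0\<^sub>m d d \<in> op_span d S"
    using submodule.zero_closed[OF sub] by (simp add: module_mat_simps)
  show "X + Y \<in> op_span d S" if "X \<in> op_span d S" "Y \<in> op_span d S"
    using submodule.m_closed[OF sub that] by (simp add: module_mat_simps)
  show "c \<cdot>\<^sub>m X \<in> op_span d S" if "X \<in> op_span d S"
    using submodule.smult_closed[OF sub _ that, of c] by (simp add: module_mat_simps)
  show "X \<in> op_span d S" if "X \<in> S"
    using in_own_span[of S] assms that by (auto simp: op_span_def)
  show "op_span d S \<subseteq> carrier_mat d d"
    using submodule.subset[OF sub] by (simp add: module_mat_simps)
qed

text \<open>The operators satisfying \<open>P\<close> form a submodule containing \<open>S\<close>,
  which therefore contains the span. The carrier premises of \<open>add\<close> and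
  \<open>smult\<close> supply the dimensions that matrix identities ask for.\<close>

lemma op_span_induct [consumes 2, case_names zero base add smult]:
  assumes "S \<subseteq> carrier_mat d d" and "X \<in> op_span d S"
    and "P (0\<^sub>m d d)"
    and "\<And>X. X \<in> S \<Longrightarrow> P X"
    and "\<And>X Y. \<lbrakk>X \<in> carrier_mat d d; Y \<in> carrier_mat d d; P X; P Y\<rbrakk> \<Longrightarrow> P (X + Y)"
    and "\<And>c X. \<lbrakk>X \<in> carrier_mat d d; P X\<rbrakk> \<Longrightarrow> P (c \<cdot>\<^sub>m X)"
  shows "P X"
proof -
  interpret matrix_vs d d "TYPE(complex)" .
  let ?N = "{X \<in> carrier_mat d d. P X}"
  have "submodule class_ring ?N (op_space d)"
    using assms(3,5,6) by unfold_locales (auto simp: module_mat_simps)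
  moreover have "S \<subseteq> ?N" using assms(1,4) by auto
  ultimately have "op_span d S \<subseteq> ?N"
    using span_is_subset[of S ?N] by (simp add: op_span_def)
  then show ?thesis using assms(2) by auto
qed

lemma op_span_minimal:
  assumes "T \<subseteq> carrier_mat d d" and "S \<subseteq> op_span d T"
  shows "op_span d S \<subseteq> op_span d T"
proof
  fix X
  have S: "S \<subseteq> carrier_mat d d"
    using assms op_span_carrier by blast
  assume "X \<in> op_span d S"
  with S show "X \<in> op_span d T"
    by (induction rule: op_span_induct)
      (use assms in \<open>auto intro: op_span_zero op_span_add op_span_smult\<close>)
qed

lemma op_span_finsum:
  assumes "S \<subseteq> carrier_mat d d" "finite A" "f \<in> A \<rightarrow> op_span d S"
  shows "finsum (op_space d) f A \<in> op_span d S"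
  using assms(2,3)
proof (induction A)
  case empty
  then show ?case using assms(1) by (simp add: finsum_op_space_empty op_span_zero)
next
  case (insert a A)
  then have "f \<in> insert a A \<rightarrow> carrier_mat d d"
    using op_span_carrier[OF assms(1)] by blast
  then show ?case
    using insert assms(1) by (auto simp: finsum_op_space_insert intro: op_span_add)
qed

text \<open>Bilinearity: an induction over \<open>X\<close> with an inner induction over
  \<open>Y\<close> reduces products of two spans to products of generators.\<close>

lemma op_span_mult:
  assumes R: "R \<subseteq> carrier_mat d d" and S: "S \<subseteq> carrier_mat d d" and T: "T \<subseteq> carrier_mat d d"
    and ST: "\<And>X Y. X \<in> S \<Longrightarrow> Y \<in> T \<Longrightarrow> X * Y \<in> op_span d R"
    and X: "X \<in> op_span d S" and Y: "Y \<in> op_span d T"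
  shows "X * Y \<in> op_span d R"
  using S X
proof (induction rule: op_span_induct)
  case zero
  have "Y \<in> carrier_mat d d" using op_span_carrier[OF T] Y by auto
  then show ?case using op_span_zero[OF R] by simp
next
  case (base X)
  then have X: "X \<in> carrier_mat d d" using S by auto
  show ?case using T Y
  proof (induction rule: op_span_induct)
    case zero
    then show ?case using X op_span_zero[OF R] by simp
  next
    case (base Y)
    then show ?case using ST \<open>X \<in> S\<close> by simp
  next
    case (add Y Z)
    then show ?case using X op_span_add[OF R]
      by (simp add: mult_add_distrib_mat[of _ d d _ d])
  next
    case (smult c Y)
    then show ?case using X op_span_smult[OF R]
      by (simp add: mult_smult_distrib[of _ d d _ d])
  qed
next
  case (add X Z)
  moreover have "Y \<in> carrier_mat d d" using op_span_carrier[OF T] Y by auto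
  ultimately show ?case using op_span_add[OF R]
    by (simp add: add_mult_distrib_mat[of _ d d _ _ d])
next
  case (smult c X)
  moreover have "Y \<in> carrier_mat d d" using op_span_carrier[OF T] Y by auto
  ultimately show ?case using op_span_smult[OF R]
    by (simp add: mult_smult_assoc_mat[of _ d d _ d])
qed

section \<open>The Hilbert--Schmidt inner product\<close>

lemma mat_adjoint_dim [simp]:
  "dim_row (mat_adjoint A) = dim_col A" "dim_col (mat_adjoint A) = dim_row A"
  by (simp_all add: mat_adjoint_def)

lemma mat_adjoint_index:
  fixes A :: "complex mat"
  shows "i < dim_col A \<Longrightarrow> j < dim_row A \<Longrightarrow> mat_adjoint A $$ (i, j) = cnj (A $$ (j, i))"
  by (simp add: mat_adjoint_def mat_of_rows_index)

lemma mat_adjoint_carrier [simp]: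
  "mat_adjoint A \<in> carrier_mat m n \<longleftrightarrow> A \<in> carrier_mat n m"
  unfolding carrier_mat_def by auto

lemma mat_adjoint_mult:
  fixes A B :: "complex mat"
  assumes "A \<in> carrier_mat n m" "B \<in> carrier_mat m k"
  shows "mat_adjoint (A * B) = mat_adjoint B * mat_adjoint A"
  using assms
  by (intro eq_matI) (auto simp: mat_adjoint_index scalar_prod_def mult.commute intro!: sum.cong)

lemma mat_adjoint_smult:
  fixes A :: "complex mat"
  shows "mat_adjoint (c \<cdot>\<^sub>m A) = cnj c \<cdot>\<^sub>m mat_adjoint A"
  by (intro eq_matI) (auto simp: mat_adjoint_index)

lemma mat_adjoint_one [simp]: "mat_adjoint (1\<^sub>m n :: complex mat) = 1\<^sub>m n"
  by (intro eq_matI) (auto simp: mat_adjoint_index)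

lemma mat_adjoint_adjoint [simp]: "mat_adjoint (mat_adjoint A) = (A :: complex mat)"
  by (intro eq_matI) (auto simp: mat_adjoint_index)

lemma mat_trace_mult:
  assumes "A \<in> carrier_mat n m" "B \<in> carrier_mat m n"
  shows "mat_trace (A * B) = (\<Sum>i<n. \<Sum>k<m. A $$ (i, k) * B $$ (k, i))"
  using assms by (auto simp: mat_trace_def scalar_prod_def lessThan_atLeast0 intro!: sum.cong)

lemma mat_trace_mult_commute:
  assumes "A \<in> carrier_mat n m" "B \<in> carrier_mat m n"
  shows "mat_trace (A * B) = mat_trace (B * A)"
  unfolding mat_trace_mult[OF assms] mat_trace_mult[OF assms(2,1)]
  by (subst sum.swap) (simp add: mult.commute)

lemma mat_trace_smult: "mat_trace (c \<cdot>\<^sub>m A) = c * mat_trace A" if "A \<in> carrier_mat n n"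
  using that by (auto simp: mat_trace_def sum_distrib_left intro!: sum.cong)

lemma hs_inner_eq_sum:
  assumes "E \<in> carrier_mat d d" "F \<in> carrier_mat d d"
  shows "hs_inner E F = (\<Sum>p\<in>{..<d} \<times> {..<d}. cnj (E $$ p) * F $$ p)"
proof -
  have "hs_inner E F = (\<Sum>i<d. \<Sum>k<d. cnj (E $$ (k, i)) * F $$ (k, i))"
    unfolding hs_inner_def using assms
    by (subst mat_trace_mult[of _ d d]) (auto simp: mat_adjoint_index intro!: sum.cong)
  also have "\<dots> = (\<Sum>k<d. \<Sum>i<d. cnj (E $$ (k, i)) * F $$ (k, i))"
    by (rule sum.swap)
  finally show ?thesis by (simp add: sum.cartesian_product split_def)
qed

lemma hs_inner_add_right:
  assumes "E \<in> carrier_mat d d" "X \<in> carrier_mat d d" "Y \<in> carrier_mat d d"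
  shows "hs_inner E (X + Y) = hs_inner E X + hs_inner E Y"
proof -
  have "hs_inner E (X + Y) =
      (\<Sum>p\<in>{..<d} \<times> {..<d}. cnj (E $$ p) * X $$ p + cnj (E $$ p) * Y $$ p)"
    unfolding hs_inner_eq_sum[OF assms(1) add_carrier_mat[OF assms(3)]]
    using assms by (intro sum.cong) (auto simp: distrib_left)
  then show ?thesis
    using assms by (simp add: hs_inner_eq_sum sum.distrib)
qed

lemma hs_inner_smult_right:
  assumes "E \<in> carrier_mat d d" "X \<in> carrier_mat d d"
  shows "hs_inner E (c \<cdot>\<^sub>m X) = c * hs_inner E X"
  unfolding hs_inner_eq_sum[OF assms] hs_inner_eq_sum[OF assms(1) smult_carrier_mat[OF assms(2)]]
    sum_distrib_left
  using assms by (intro sum.cong) auto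

lemma hs_inner_zero_right: "E \<in> carrier_mat d d \<Longrightarrow> hs_inner E (0\<^sub>m d d) = 0"
  using hs_inner_smult_right[of E d "0\<^sub>m d d" 0] by simp

lemma hs_inner_commute:
  assumes "E \<in> carrier_mat d d" "X \<in> carrier_mat d d"
  shows "hs_inner X E = cnj (hs_inner E X)"
  unfolding hs_inner_eq_sum[OF assms] hs_inner_eq_sum[OF assms(2,1)] by (simp add: mult.commute)

lemma hs_inner_smult_left:
  assumes "E \<in> carrier_mat d d" "X \<in> carrier_mat d d"
  shows "hs_inner (c \<cdot>\<^sub>m E) X = cnj c * hs_inner E X"
proof -
  have "hs_inner (c \<cdot>\<^sub>m E) X = cnj (hs_inner X (c \<cdot>\<^sub>m E))"
    using assms by (intro hs_inner_commute) auto
  then show ?thesis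
    using assms by (simp add: hs_inner_smult_right hs_inner_commute[of X d E])
qed

lemma hs_inner_finsum_right:
  assumes "finite A" "E \<in> carrier_mat d d" "f \<in> A \<rightarrow> carrier_mat d d"
  shows "hs_inner E (finsum (op_space d) f A) = (\<Sum>a\<in>A. hs_inner E (f a))"
  using assms(1,3)
proof (induction A)
  case empty
  then show ?case using assms(2) by (simp add: finsum_op_space_empty hs_inner_zero_right)
next
  case (insert a A)
  then have "finsum (op_space d) f A \<in> carrier_mat d d"
    by (intro finsum_op_space_carrier) auto
  then show ?case using insert assms(2)
    by (auto simp: finsum_op_space_insert hs_inner_add_right[of _ d])
qed

text \<open>Cyclicity of the trace moves the two-sided multiplication to the other argument. The
  action of \<Phi> on an arbitrary \<open>X\<close> can then be read off from conjugated
  monomials.\<close>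

lemma hs_inner_mult_mult:
  assumes "E \<in> carrier_mat d d" "X \<in> carrier_mat d d" "Y \<in> carrier_mat d d" "Z \<in> carrier_mat d d"
  shows "hs_inner E (Y * X * Z) = hs_inner (mat_adjoint Y * E * mat_adjoint Z) X"
proof -
  note c = assms mult_carrier_mat[of _ d d _ d]
  note assoc = assoc_mult_mat[of _ d d _ d _ d]
  have "hs_inner E (Y * X * Z) = mat_trace ((mat_adjoint E * Y * X) * Z)"
    unfolding hs_inner_def by (simp add: c assoc)
  also have "\<dots> = mat_trace (Z * (mat_adjoint E * Y * X))"
    by (rule mat_trace_mult_commute[of _ d d]) (simp_all add: c)
  also have "Z * (mat_adjoint E * Y * X) = mat_adjoint (mat_adjoint Y * E * mat_adjoint Z) * X"
    by (simp add: c mat_adjoint_mult[of _ d d _ d] assoc)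
  finally show ?thesis by (simp add: hs_inner_def)
qed

section \<open>Orthonormal families\<close>

text \<open>Both sides are linear in \<open>X\<close>, and on a member of \<open>B\<close>
  orthonormality leaves a single term. The entrywise form is the one that kernel sums
  consume.\<close>

lemma orthonormal_expansion:
  assumes B: "finite B" "B \<subseteq> carrier_mat d d"
    and orth: "\<forall>E\<in>B. \<forall>F\<in>B. hs_inner E F = (if E = F then 1 else 0)"
    and X: "X \<in> op_span d B" and p: "p \<in> {..<d} \<times> {..<d}"
  shows "X $$ p = (\<Sum>E\<in>B. hs_inner E X * E $$ p)"
  using B(2) X
proof (induction rule: op_span_induct)
  case zero
  have "hs_inner E (0\<^sub>m d d) = 0" if "E \<in> B" for E
    using that B by (intro hs_inner_zero_right) auto
  then show ?case using p by auto
next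
  case (base X)
  have "(\<Sum>E\<in>B. hs_inner E X * E $$ p) = (\<Sum>E\<in>B. if E = X then E $$ p else 0)"
    using orth base by (intro sum.cong) auto
  also have "\<dots> = X $$ p" using B base by simp
  finally show ?case by simp
next
  case (add X Y)
  have "(\<Sum>E\<in>B. hs_inner E (X + Y) * E $$ p) =
      (\<Sum>E\<in>B. hs_inner E X * E $$ p + hs_inner E Y * E $$ p)"
    using add B by (intro sum.cong) (auto simp: hs_inner_add_right[of _ d] algebra_simps)
  then show ?case using add p by (auto simp: sum.distrib)
next
  case (smult c X)
  have "(\<Sum>E\<in>B. hs_inner E (c \<cdot>\<^sub>m X) * E $$ p) = (\<Sum>E\<in>B. c * (hs_inner E X * E $$ p))"
    using smult B by (intro sum.cong) (auto simp: hs_inner_smult_right[of _ d] algebra_simps)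
  then show ?case using smult p by (auto simp flip: sum_distrib_left)
qed

text \<open>The kernel on the left-hand side is that of the orthogonal projection onto \<open>V\<close>; both
  \<open>\<Phi>\<close> and \<open>\<Pi>\<close> can be computed from it.\<close>

lemma onb_kernel_unique:
  assumes V: "V \<subseteq> carrier_mat d d"
    and B: "hs_orthonormal_basis d V B" and C: "hs_orthonormal_basis d V C"
    and p: "p \<in> {..<d} \<times> {..<d}" and q: "q \<in> {..<d} \<times> {..<d}"
  shows "(\<Sum>E\<in>B. E $$ p * cnj (E $$ q)) = (\<Sum>F\<in>C. F $$ p * cnj (F $$ q))"
proof -
  note B' = B[unfolded hs_orthonormal_basis_def] and C' = C[unfolded hs_orthonormal_basis_def]
  have exp: "X $$ r = (\<Sum>E\<in>D. hs_inner E X * E $$ r)"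
    if "hs_orthonormal_basis d V D" "X \<in> V" "r \<in> {..<d} \<times> {..<d}" for D X r
    using orthonormal_expansion[of D d X r] that V by (auto simp: hs_orthonormal_basis_def)
  \<comment> \<open>\<open>E\<close> is expanded over \<open>C\<close>; once the sums are exchanged,
    conjugate symmetry turns the sum over \<open>B\<close> into the conjugated expansion of
    \<open>F\<close>.\<close>
  have "(\<Sum>E\<in>B. E $$ p * cnj (E $$ q)) = (\<Sum>E\<in>B. \<Sum>F\<in>C. hs_inner F E * F $$ p * cnj (E $$ q))"
    using B' exp[OF C _ p] by (intro sum.cong) (auto simp flip: sum_distrib_right)
  also have "\<dots> = (\<Sum>F\<in>C. \<Sum>E\<in>B. hs_inner F E * F $$ p * cnj (E $$ q))"
    by (rule sum.swap)
  also have "\<dots> = (\<Sum>F\<in>C. F $$ p * cnj (\<Sum>E\<in>B. hs_inner E F * E $$ q))"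
  proof (intro sum.cong refl)
    fix F assume "F \<in> C"
    then have "hs_inner F E = cnj (hs_inner E F)" if "E \<in> B" for E
      using that B' C' V by (intro hs_inner_commute[of _ d]) auto
    then show "(\<Sum>E\<in>B. hs_inner F E * F $$ p * cnj (E $$ q)) =
        F $$ p * cnj (\<Sum>E\<in>B. hs_inner E F * E $$ q)"
      by (simp add: sum_distrib_left mult_ac)
  qed
  also have "\<dots> = (\<Sum>F\<in>C. F $$ p * cnj (F $$ q))"
    using C' exp[OF B _ q] by (intro sum.cong refl) auto
  finally show ?thesis .
qed

section \<open>Coordinate formulas for \<Phi> and \<Pi>, and their independence of the basis\<close>

lemma Phi_map_carrier:
  assumes "B \<subseteq> carrier_mat d d" "X \<in> carrier_mat d d"
  shows "Phi_map d B X \<in> carrier_mat d d"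
  unfolding Phi_map_def using assms by (intro finsum_op_space_carrier) auto

lemma Pi_map_carrier:
  assumes "B \<subseteq> carrier_mat d d"
  shows "Pi_map d B X \<in> carrier_mat d d"
  unfolding Pi_map_def using assms by (intro finsum_op_space_carrier) auto

text \<open>Each \<open>E\<close> enters only through products of an entry with a conjugated entry,
  so \<Phi> is the projection kernel with its four indices regrouped: \<open>(i, k)\<close> against
  \<open>(j, l)\<close>, where \<Pi> has output position against input position.\<close>

lemma Phi_map_index:
  assumes B: "finite B" "B \<subseteq> carrier_mat d d" and X: "X \<in> carrier_mat d d" and ij: "i < d" "j < d"
  shows "Phi_map d B X $$ (i, j) =
    (\<Sum>k<d. \<Sum>l<d. X $$ (k, l) * (\<Sum>E\<in>B. E $$ (i, k) * cnj (E $$ (j, l))))"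
proof -
  have "(E * X * mat_adjoint E) $$ (i, j) =
      (\<Sum>k<d. \<Sum>l<d. X $$ (k, l) * (E $$ (i, k) * cnj (E $$ (j, l))))" if "E \<in> B" for E
    using that B X ij
    by (auto simp: scalar_prod_def mat_adjoint_index lessThan_atLeast0 sum_distrib_left mult_ac
        intro!: sum.cong dest!: subsetD)
  then have "Phi_map d B X $$ (i, j) = (\<Sum>E\<in>B. \<Sum>k<d. \<Sum>l<d. X $$ (k, l) * (E $$ (i, k) * cnj (E $$ (j, l))))"
    unfolding Phi_map_def using B X ij by (subst finsum_op_space_index) (auto intro!: sum.cong)
  also have "\<dots> = (\<Sum>k<d. \<Sum>E\<in>B. \<Sum>l<d. X $$ (k, l) * (E $$ (i, k) * cnj (E $$ (j, l))))"
    by (rule sum.swap)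
  also have "\<dots> = (\<Sum>k<d. \<Sum>l<d. \<Sum>E\<in>B. X $$ (k, l) * (E $$ (i, k) * cnj (E $$ (j, l))))"
    by (intro sum.cong refl sum.swap)
  finally show ?thesis by (simp add: sum_distrib_left)
qed

lemma Pi_map_index:
  assumes B: "finite B" "B \<subseteq> carrier_mat d d" and X: "X \<in> carrier_mat d d"
    and p: "p \<in> {..<d} \<times> {..<d}"
  shows "Pi_map d B X $$ p =
    (\<Sum>q\<in>{..<d} \<times> {..<d}. X $$ q * (\<Sum>E\<in>B. E $$ p * cnj (E $$ q)))"
proof -
  have "Pi_map d B X $$ p = (\<Sum>E\<in>B. (hs_inner E X \<cdot>\<^sub>m E) $$ p)"
    unfolding Pi_map_def using B p by (subst finsum_op_space_index) auto
  also have "\<dots> = (\<Sum>E\<in>B. \<Sum>q\<in>{..<d} \<times> {..<d}. X $$ q * (E $$ p * cnj (E $$ q)))"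
  proof (intro sum.cong refl)
    fix E assume "E \<in> B"
    then have E: "E \<in> carrier_mat d d" using B by auto
    then have "(hs_inner E X \<cdot>\<^sub>m E) $$ p = hs_inner E X * E $$ p" using p by auto
    then show "(hs_inner E X \<cdot>\<^sub>m E) $$ p = (\<Sum>q\<in>{..<d} \<times> {..<d}. X $$ q * (E $$ p * cnj (E $$ q)))"
      unfolding hs_inner_eq_sum[OF E X] sum_distrib_right by (simp add: mult_ac)
  qed
  also have "\<dots> = (\<Sum>q\<in>{..<d} \<times> {..<d}. \<Sum>E\<in>B. X $$ q * (E $$ p * cnj (E $$ q)))"
    by (rule sum.swap)
  finally show ?thesis by (simp add: sum_distrib_left)
qed

text \<open>\<open>is_W_family\<close> quantifies over all orthonormal bases of the layers; this
  reduces it to the bases of normalised monomials.\<close>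

lemma onb_maps_unique:
  assumes V: "V \<subseteq> carrier_mat d d"
    and B: "hs_orthonormal_basis d V B" and C: "hs_orthonormal_basis d V C"
    and X: "X \<in> carrier_mat d d"
  shows "Phi_map d B X = Phi_map d C X" and "Pi_map d B X = Pi_map d C X"
proof -
  have BC: "finite B" "B \<subseteq> carrier_mat d d" "finite C" "C \<subseteq> carrier_mat d d"
    using B C V by (auto simp: hs_orthonormal_basis_def)
  note ker = onb_kernel_unique[OF V B C]
  have "Phi_map d B X $$ (i, j) = Phi_map d C X $$ (i, j)" if "i < d" "j < d" for i j
    using that BC X by (auto simp: Phi_map_index ker intro!: sum.cong)
  then show "Phi_map d B X = Phi_map d C X"
    using Phi_map_carrier[OF BC(2) X] Phi_map_carrier[OF BC(4) X] by (intro eq_matI) auto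
  have "Pi_map d B X $$ (i, j) = Pi_map d C X $$ (i, j)" if "i < d" "j < d" for i j
    using that BC X by (auto simp: Pi_map_index ker intro!: sum.cong)
  then show "Pi_map d B X = Pi_map d C X"
    using Pi_map_carrier[OF BC(2), of X] Pi_map_carrier[OF BC(4), of X] by (intro eq_matI) auto
qed

text \<open>As vectors, the members of the family are the columns of a square matrix \<open>M\<close> with
  \<open>M\<^sup>* M = 1\<close>; then also \<open>M M\<^sup>* = 1\<close>.\<close>

lemma orthonormal_complete:
  assumes I: "finite I" "card I = d * d" and e: "\<And>s. s \<in> I \<Longrightarrow> e s \<in> carrier_mat d d"
    and orth: "\<And>s t. s \<in> I \<Longrightarrow> t \<in> I \<Longrightarrow> hs_inner (e s) (e t) = (if s = t then 1 else 0)"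
    and p: "p \<in> {..<d} \<times> {..<d}" and q: "q \<in> {..<d} \<times> {..<d}"
  shows "(\<Sum>s\<in>I. e s $$ p * cnj (e s $$ q)) = (if p = q then 1 else 0)"
proof -
  define N where "N = d * d"
  obtain f where f: "bij_betw f {0..<N} I"
    using ex_bij_betw_nat_finite[OF I(1)] I(2) by (auto simp: N_def)
  obtain g where g: "bij_betw g {0..<N} ({..<d} \<times> {..<d})"
    using ex_bij_betw_nat_finite[of "{..<d} \<times> {..<d}"] by (auto simp: N_def card_cartesian_product)
  have fI: "f c \<in> I" if "c < N" for c using f that by (auto simp: bij_betw_def)
  have finj: "f c = f c' \<longleftrightarrow> c = c'" if "c < N" "c' < N" for c c'
    using f that by (auto simp: bij_betw_def inj_on_def)
  \<comment> \<open>Row \<open>r\<close> stands for the matrix position \<open>g r\<close> and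
    column \<open>c\<close> for the family member \<open>f c\<close>; \<open>card I = d * d\<close>
    is what makes \<open>M\<close> square.\<close>
  define M where "M = mat N N (\<lambda>(r, c). e (f c) $$ (g r))"
  have M: "M \<in> carrier_mat N N" by (simp add: M_def)
  have "mat_adjoint M * M = 1\<^sub>m N"
  proof (rule eq_matI)
    fix a b assume "a < dim_row (1\<^sub>m N :: complex mat)" "b < dim_col (1\<^sub>m N :: complex mat)"
    then have ab: "a < N" "b < N" by auto
    have "(mat_adjoint M * M) $$ (a, b) = (\<Sum>r=0..<N. cnj (e (f a) $$ (g r)) * e (f b) $$ (g r))"
      using ab M by (auto simp: scalar_prod_def mat_adjoint_index M_def intro!: sum.cong)
    also have "\<dots> = (\<Sum>p\<in>{..<d} \<times> {..<d}. cnj (e (f a) $$ p) * e (f b) $$ p)"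
      by (rule sum.reindex_bij_betw[OF g])
    also have "\<dots> = hs_inner (e (f a)) (e (f b))"
      using ab e fI by (intro hs_inner_eq_sum[symmetric]) auto
    also have "\<dots> = 1\<^sub>m N $$ (a, b)" using ab fI finj by (simp add: orth)
    finally show "(mat_adjoint M * M) $$ (a, b) = 1\<^sub>m N $$ (a, b)" .
  qed (use M in auto)
  then have MM: "M * mat_adjoint M = 1\<^sub>m N"
    using mat_mult_left_right_inverse[of "mat_adjoint M" N M] M by auto
  have surj: "\<exists>r<N. g r = p" if "p \<in> {..<d} \<times> {..<d}" for p
    using that unfolding bij_betw_imp_surj_on[OF g, symmetric] by (auto)
  obtain r r' where r: "r < N" "g r = p" and r': "r' < N" "g r' = q"
    using surj[OF p] surj[OF q] by blast
  have "(\<Sum>s\<in>I. e s $$ p * cnj (e s $$ q)) = (\<Sum>c=0..<N. e (f c) $$ p * cnj (e (f c) $$ q))"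
    by (rule sum.reindex_bij_betw[OF f, symmetric])
  also have "\<dots> = (M * mat_adjoint M) $$ (r, r')"
    using r r' M by (auto simp: scalar_prod_def mat_adjoint_index M_def intro!: sum.cong)
  also have "\<dots> = (if p = q then 1 else 0)"
    unfolding MM using r r' g by (auto simp: bij_betw_def inj_on_def)
  finally show ?thesis .
qed

text \<open>Contracting the completeness relation with the entries of \<open>X\<close> gives the
  expansion directly.\<close>

lemma orthonormal_complete_expansion:
  assumes I: "finite I" "card I = d * d" and e: "\<And>s. s \<in> I \<Longrightarrow> e s \<in> carrier_mat d d"
    and orth: "\<And>s t. s \<in> I \<Longrightarrow> t \<in> I \<Longrightarrow> hs_inner (e s) (e t) = (if s = t then 1 else 0)"
    and X: "X \<in> carrier_mat d d"
  shows "X = (\<Oplus>\<^bsub>op_space d\<^esub>s\<in>I. hs_inner (e s) X \<cdot>\<^sub>m e s)"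
proof -
  let ?Y = "\<Oplus>\<^bsub>op_space d\<^esub>s\<in>I. hs_inner (e s) X \<cdot>\<^sub>m e s"
  have Y: "?Y \<in> carrier_mat d d" using e by (intro finsum_op_space_carrier) auto
  have "?Y $$ p = X $$ p" if p: "p \<in> {..<d} \<times> {..<d}" for p
  proof -
    have "?Y $$ p = (\<Sum>s\<in>I. (hs_inner (e s) X \<cdot>\<^sub>m e s) $$ p)"
      using I e p by (subst finsum_op_space_index) auto
    also have "\<dots> = (\<Sum>s\<in>I. \<Sum>q\<in>{..<d} \<times> {..<d}. X $$ q * (e s $$ p * cnj (e s $$ q)))"
    proof (intro sum.cong refl)
      fix s assume "s \<in> I"
      then have E: "e s \<in> carrier_mat d d" using e by auto
      then have "(hs_inner (e s) X \<cdot>\<^sub>m e s) $$ p = hs_inner (e s) X * e s $$ p" using p by auto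
      then show "(hs_inner (e s) X \<cdot>\<^sub>m e s) $$ p =
          (\<Sum>q\<in>{..<d} \<times> {..<d}. X $$ q * (e s $$ p * cnj (e s $$ q)))"
        unfolding hs_inner_eq_sum[OF E X] sum_distrib_right by (simp add: mult_ac)
    qed
    also have "\<dots> = (\<Sum>q\<in>{..<d} \<times> {..<d}. X $$ q * (\<Sum>s\<in>I. e s $$ p * cnj (e s $$ q)))"
      by (subst sum.swap) (simp add: sum_distrib_left)
    also have "\<dots> = (\<Sum>q\<in>{..<d} \<times> {..<d}. if p = q then X $$ q else 0)"
      using orthonormal_complete[OF I e orth p] by (intro sum.cong) auto
    also have "\<dots> = X $$ p" using p by simp
    finally show ?thesis .
  qed
  then show ?thesis using X Y by (intro eq_matI) auto
qed

section \<open>Counting subsets\<close>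

lemma card_symmetric_difference_even:
  assumes "finite S" "finite T" "even (card S)" "even (card T)"
  shows "even (card ((S - T) \<union> (T - S)))"
proof -
  have "card ((S - T) \<union> (T - S)) = card (S - T) + card (T - S)"
    using assms by (intro card_Un_disjoint) auto
  moreover have "card S = card (S - T) + card (S \<inter> T)" "card T = card (T - S) + card (S \<inter> T)"
    using assms card_Int_Diff[of S T] card_Int_Diff[of T S] by (simp_all add: Int_commute)
  ultimately show ?thesis using assms by presburger
qed

text \<open>A fixed element \<open>a\<close> acts as a parity bit: any subset of
  \<open>A - {a}\<close> becomes even in exactly one way, by adding \<open>a\<close> or not.
  Nonemptiness is essential, since the empty set has one even subset.\<close>

lemma card_even_subsets:
  assumes "finite A" "A \<noteq> {}"
  shows "2 * card {S. S \<subseteq> A \<and> even (card S)} = 2 ^ card A"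
proof -
  obtain a where a: "a \<in> A" using assms by auto
  have fin: "finite S" if "S \<subseteq> A" for S using that assms finite_subset by auto
  let ?f = "\<lambda>S. if even (card S) then S else insert a S"
  have "bij_betw ?f (Pow (A - {a})) {S. S \<subseteq> A \<and> even (card S)}"
  proof (rule bij_betw_byWitness[where f' = "\<lambda>S. S - {a}"])
    show "\<forall>S\<in>Pow (A - {a}). ?f S - {a} = S" by auto
    have "?f (S - {a}) = S" if "S \<subseteq> A" "even (card S)" for S
    proof (cases "a \<in> S")
      case True
      then have "Suc (card (S - {a})) = card S" using fin[OF that(1)] by (intro card_Suc_Diff1)
      then have "odd (card (S - {a}))" using that(2) by (metis even_Suc)
      then show ?thesis using True by (simp add: insert_absorb)
    qed (use that in auto)
    then show "\<forall>S\<in>{S. S \<subseteq> A \<and> even (card S)}. ?f (S - {a}) = S"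
      by blast
    have "even (card (insert a S))" if "S \<subseteq> A - {a}" "odd (card S)" for S
    proof -
      have "finite S" "a \<notin> S" using that fin[of S] by auto
      then show ?thesis using that by simp
    qed
    then show "?f ` Pow (A - {a}) \<subseteq> {S. S \<subseteq> A \<and> even (card S)}"
      using a by auto
    show "(\<lambda>S. S - {a}) ` {S. S \<subseteq> A \<and> even (card S)} \<subseteq> Pow (A - {a})" by auto
  qed
  then have "card {S. S \<subseteq> A \<and> even (card S)} = card (Pow (A - {a}))"
    by (simp add: bij_betw_same_card)
  also have "\<dots> = 2 ^ card (A - {a})" using assms by (intro card_Pow) auto
  finally show ?thesis
    using assms a by (simp add: card_Suc_Diff1[symmetric, OF assms(1) a] del: card_Diff_insert)
qed

text \<open>\<open>T\<close> amounts to an independent choice of \<open>T \<inter> S\<close> and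
  \<open>T - S\<close>, and the summand depends on the size of the former only. For \<open>s\<close>
  beyond \<open>card S\<close> the binomial coefficient vanishes, so \<open>s\<close> may run up to
  \<open>m\<close>.\<close>

lemma sum_subsets_of_card_split:
  fixes g :: "nat \<Rightarrow> 'b :: comm_semiring_1"
  assumes "finite A" "S \<subseteq> A"
  shows "(\<Sum>T | T \<subseteq> A \<and> card T = m. g (card (T \<inter> S))) =
    (\<Sum>s = 0..m. g s * of_nat (card S choose s) * of_nat ((card A - card S) choose (m - s)))"
proof -
  have S: "finite S" using assms finite_subset by auto
  let ?P = "\<lambda>s. {X. X \<subseteq> S \<and> card X = s} \<times> {Y. Y \<subseteq> A - S \<and> card Y = m - s}"
  have fin: "finite (?P s)" for s using assms(1) S by auto
  have split: "card (X \<union> Y) = card X + card Y" "(X \<union> Y) \<inter> S = X"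
    if "X \<subseteq> S" "Y \<subseteq> A - S" for X Y
  proof -
    have "finite X" "finite Y" "X \<inter> Y = {}"
      using that assms(1) S finite_subset[of Y "A - S"] finite_subset[of X S] by auto
    then show "card (X \<union> Y) = card X + card Y" by (rule card_Un_disjoint)
    show "(X \<union> Y) \<inter> S = X" using that by auto
  qed
  have "(\<Sum>s = 0..m. g s * of_nat (card S choose s) * of_nat ((card A - card S) choose (m - s)))
      = (\<Sum>s = 0..m. \<Sum>z\<in>?P s. g s)"
  proof (intro sum.cong refl)
    fix s
    have "card (?P s) = (card S choose s) * ((card A - card S) choose (m - s))"
      using assms S by (simp add: card_cartesian_product n_subsets card_Diff_subset)
    then show "g s * of_nat (card S choose s) * of_nat ((card A - card S) choose (m - s)) =
        (\<Sum>z\<in>?P s. g s)"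
      by (simp add: mult_ac)
  qed
  also have "\<dots> = (\<Sum>(s, z)\<in>Sigma {0..m} ?P. g s)"
    using fin by (subst sum.Sigma) auto
  also have "\<dots> = (\<Sum>T | T \<subseteq> A \<and> card T = m. g (card (T \<inter> S)))"
  proof (rule sum.reindex_bij_witness[where j = "\<lambda>(s, X, Y). X \<union> Y"
        and i = "\<lambda>T. (card (T \<inter> S), T \<inter> S, T - S)"])
    fix T assume "T \<in> {T. T \<subseteq> A \<and> card T = m}"
    then have T: "T \<subseteq> A" "card T = m" "finite T" using assms(1) finite_subset by auto
    have "m = card (T \<inter> S) + card (T - S)"
      using card_Int_Diff[OF T(3), of S] T(2) by simp
    then show "(card (T \<inter> S), T \<inter> S, T - S) \<in> Sigma {0..m} ?P"
      using T by auto
    show "(case (card (T \<inter> S), T \<inter> S, T - S) of (s, X, Y) \<Rightarrow> X \<union> Y) = T" by auto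
  next
    fix z assume z: "z \<in> Sigma {0..m} ?P"
    obtain s X Y where z': "z = (s, X, Y)" by (cases z)
    then have XY: "X \<subseteq> S" "Y \<subseteq> A - S" "card X = s" "card Y = m - s" "s \<le> m" using z by auto
    show "(case z of (s, X, Y) \<Rightarrow> X \<union> Y) \<in> {T. T \<subseteq> A \<and> card T = m}"
      using XY split(1)[OF XY(1,2)] assms(2) z' by auto
    show "(card ((case z of (s, X, Y) \<Rightarrow> X \<union> Y) \<inter> S), (case z of (s, X, Y) \<Rightarrow> X \<union> Y) \<inter> S,
        (case z of (s, X, Y) \<Rightarrow> X \<union> Y) - S) = z"
      using XY split(2)[OF XY(1,2)] z' by auto
    show "g (card ((case z of (s, X, Y) \<Rightarrow> X \<union> Y) \<inter> S)) = (case z of (s, z) \<Rightarrow> g s)"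
      using XY split(2)[OF XY(1,2)] z' by auto
  qed
  finally show ?thesis by simp
qed

section \<open>Monomials in anticommuting Hermitian unitaries\<close>

lemma smult_smult_mat: "c \<cdot>\<^sub>m (k \<cdot>\<^sub>m A) = (c * k) \<cdot>\<^sub>m (A :: 'a :: semigroup_mult mat)"
  by (intro eq_matI) (auto simp: mult.assoc)

lemma one_smult_mat: "1 \<cdot>\<^sub>m A = (A :: 'a :: monoid_mult mat)"
  by (intro eq_matI) auto

text \<open>The condition \<open>2 * (d * d) = 2 ^ card I\<close> says that \<open>I\<close> has as
  many even subsets as the operator space has dimensions, stated without a subtraction in the
  exponent. The linear order fixes the order of factors in a product.\<close>

locale clifford =
  fixes d :: nat and I :: "'a :: linorder set" and U :: "'a \<Rightarrow> complex mat"
  assumes finite_I: "finite I"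
    and U_carrier: "a \<in> I \<Longrightarrow> U a \<in> carrier_mat d d"
    and U_adjoint: "a \<in> I \<Longrightarrow> mat_adjoint (U a) = U a"
    and U_square: "a \<in> I \<Longrightarrow> U a * U a = 1\<^sub>m d"
    and U_anticommute: "a \<in> I \<Longrightarrow> b \<in> I \<Longrightarrow> a \<noteq> b \<Longrightarrow> U a * U b = (- 1) \<cdot>\<^sub>m (U b * U a)"
    and dim: "I \<noteq> {}" "2 * (d * d) = 2 ^ card I"
begin

definition word :: "'a list \<Rightarrow> complex mat" where
  "word xs = foldr (\<lambda>a M. U a * M) xs (1\<^sub>m d)"

definition monomial :: "'a set \<Rightarrow> complex mat" where
  "monomial S = word (sorted_list_of_set S)"

definition even_sets :: "'a set set" where
  "even_sets = {S. S \<subseteq> I \<and> even (card S)}"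

lemmas assoc = assoc_mult_mat[of _ d d _ d _ d]
lemmas smult_simps = mult_smult_distrib[of _ d d _ d] mult_smult_assoc_mat[of _ d d _ d]
  smult_smult_mat one_smult_mat

lemma finite_subset_I: "S \<subseteq> I \<Longrightarrow> finite S"
  using finite_I finite_subset by auto

lemma d_pos: "d > 0"
  using dim by (cases d) auto

lemma word_simps: "word [] = 1\<^sub>m d" "word (a # xs) = U a * word xs"
  by (simp_all add: word_def)

lemma word_carrier: "set xs \<subseteq> I \<Longrightarrow> word xs \<in> carrier_mat d d"
  by (induction xs) (auto simp: word_simps intro!: mult_carrier_mat U_carrier)

lemma monomial_carrier: "S \<subseteq> I \<Longrightarrow> monomial S \<in> carrier_mat d d"
  unfolding monomial_def using finite_subset_I by (intro word_carrier) auto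

lemma word_adjoint_mult:
  assumes "set xs \<subseteq> I"
  shows "mat_adjoint (word xs) * word xs = 1\<^sub>m d"
  using assms
proof (induction xs)
  case (Cons a xs)
  then have a: "a \<in> I" and c: "U a \<in> carrier_mat d d" "word xs \<in> carrier_mat d d"
    using U_carrier word_carrier by auto
  have "mat_adjoint (word (a # xs)) * word (a # xs) = mat_adjoint (word xs) * (U a * U a) * word xs"
    using c U_adjoint[OF a] by (simp add: word_simps mat_adjoint_mult[of _ d d _ d] assoc)
  then show ?case using c Cons U_square[OF a] by simp
qed (simp add: word_simps)

lemma monomial_unitary:
  assumes "S \<subseteq> I"
  shows "mat_adjoint (monomial S) * monomial S = 1\<^sub>m d"
  unfolding monomial_def using assms finite_subset_I by (intro word_adjoint_mult) auto

lemma monomial_empty: "monomial {} = 1\<^sub>m d"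
  by (simp add: monomial_def word_simps)

section \<open>Commutation signs and products of monomials\<close>

lemma generator_word:
  assumes "a \<in> I" "set xs \<subseteq> I"
  shows "U a * word xs = (\<Prod>x\<leftarrow>xs. if x = a then 1 else - 1) \<cdot>\<^sub>m (word xs * U a)"
  using assms(2)
proof (induction xs)
  case Nil
  then show ?case using U_carrier[OF assms(1)] by (simp add: word_simps one_smult_mat)
next
  case (Cons x xs)
  let ?s = "if x = a then 1 else - 1 :: complex"
  let ?p = "\<Prod>x\<leftarrow>xs. if x = a then 1 else - 1 :: complex"
  have c: "U a \<in> carrier_mat d d" "U x \<in> carrier_mat d d" "word xs \<in> carrier_mat d d"
    using Cons assms U_carrier word_carrier by auto
  have comm: "U a * U x = ?s \<cdot>\<^sub>m (U x * U a)"
    using U_anticommute[of a x] assms Cons.prems by (auto simp: one_smult_mat)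
  have "U a * (U x * word xs) = U a * U x * word xs"
    using c by (simp add: assoc)
  also have "\<dots> = ?s \<cdot>\<^sub>m (U x * (U a * word xs))"
    unfolding comm using c by (simp add: assoc smult_simps del: if_split)
  also have "U a * word xs = ?p \<cdot>\<^sub>m (word xs * U a)"
    using Cons by simp
  also have "?s \<cdot>\<^sub>m (U x * (?p \<cdot>\<^sub>m (word xs * U a))) = (?s * ?p) \<cdot>\<^sub>m ((U x * word xs) * U a)"
    using c by (simp add: smult_simps assoc del: if_split)
  finally show ?case by (simp add: word_simps del: if_split)
qed

text \<open>Moving \<open>U a\<close> through costs a sign for each letter other than
  \<open>a\<close>: \<open>card S - 1\<close> of them if \<open>a \<in> S\<close>, otherwise
  \<open>card S\<close>. For even \<open>S\<close> the sign is -1 exactly when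
  \<open>a \<in> S\<close>; for odd sets the rule would be reversed.\<close>

lemma generator_even_monomial:
  assumes "a \<in> I" "S \<in> even_sets"
  shows "U a * monomial S = (if a \<in> S then - 1 else 1) \<cdot>\<^sub>m (monomial S * U a)"
proof -
  have S: "S \<subseteq> I" "finite S" "even (card S)"
    using assms finite_subset_I by (auto simp: even_sets_def)
  have "(\<Prod>x\<leftarrow>sorted_list_of_set S. if x = a then 1 else - 1 :: complex) =
      (\<Prod>x\<in>S. if x = a then 1 else - 1)"
    using S by (subst prod.distinct_set_conv_list[symmetric]) auto
  also have "\<dots> = (\<Prod>x\<in>S - {a}. if x = a then 1 else - 1)"
    using S by (intro prod.mono_neutral_right) auto
  also have "\<dots> = (\<Prod>x\<in>S - {a}. - 1)"
    by (intro prod.cong) auto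
  also have "\<dots> = (- 1) ^ card (S - {a})" by simp
  also have "\<dots> = (if a \<in> S then - 1 else 1)"
  proof (cases "a \<in> S")
    case True
    then have "Suc (card (S - {a})) = card S" using S by (intro card_Suc_Diff1) auto
    then have "odd (card (S - {a}))" using S(3) by (metis even_Suc)
    then show ?thesis using True by simp
  qed (use S in auto)
  finally show ?thesis
    unfolding monomial_def using S by (subst generator_word[OF assms(1)]) auto
qed

text \<open>Insertion moves \<open>U a\<close> past the smaller letters, each exchange flipping the
  sign.\<close>

lemma word_insort:
  assumes "a \<in> I" "set xs \<subseteq> I"
  shows "\<exists>\<epsilon>\<in>{1, - 1}. word (insort a xs) = \<epsilon> \<cdot>\<^sub>m (U a * word xs)"
  using assms(2)
proof (induction xs)
  case (Cons x xs)
  have c: "U a \<in> carrier_mat d d" "U x \<in> carrier_mat d d" "word xs \<in> carrier_mat d d"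
    using Cons assms U_carrier word_carrier by auto
  show ?case
  proof (cases "a \<le> x")
    case False
    obtain \<epsilon> where \<epsilon>: "\<epsilon> \<in> {1, - 1}" "word (insort a xs) = \<epsilon> \<cdot>\<^sub>m (U a * word xs)"
      using Cons by auto
    have "word (insort a (x # xs)) = \<epsilon> \<cdot>\<^sub>m ((U x * U a) * word xs)"
      using False \<epsilon> c by (simp add: word_simps smult_simps assoc)
    also have "U x * U a = (- 1) \<cdot>\<^sub>m (U a * U x)"
      using U_anticommute[of x a] False assms Cons.prems by auto
    also have "\<epsilon> \<cdot>\<^sub>m ((- 1) \<cdot>\<^sub>m (U a * U x) * word xs) = (- \<epsilon>) \<cdot>\<^sub>m (U a * word (x # xs))"
      using c by (simp add: word_simps smult_simps assoc)
    finally show ?thesis using \<epsilon>(1) by (intro bexI[of _ "- \<epsilon>"]) auto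
  qed (simp add: word_simps one_smult_mat)
qed (simp add: word_simps one_smult_mat)

lemma monomial_insert:
  assumes "a \<in> I" "S \<subseteq> I" "a \<notin> S"
  shows "\<exists>\<epsilon>\<in>{1, - 1}. monomial (insert a S) = \<epsilon> \<cdot>\<^sub>m (U a * monomial S)"
  unfolding monomial_def
  using word_insort[OF assms(1), of "sorted_list_of_set S"] assms finite_subset_I[OF assms(2)]
  by (simp add: sorted_list_of_set_insert)

text \<open>Both cases rest on \<open>monomial_insert\<close>. A new \<open>a\<close> is inserted,
  the sign being its own inverse; an \<open>a\<close> already in \<open>S\<close> is pulled to the
  front, where the square of \<open>U a\<close> cancels.\<close>

lemma generator_monomial:
  assumes "a \<in> I" "S \<subseteq> I"
  shows "\<exists>\<epsilon>\<in>{1, - 1}. U a * monomial S = \<epsilon> \<cdot>\<^sub>m monomial (({a} - S) \<union> (S - {a}))"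
proof (cases "a \<in> S")
  case True
  let ?T = "S - {a}"
  have T: "?T \<subseteq> I" "insert a ?T = S" "({a} - S) \<union> ?T = ?T" using True assms by auto
  have c: "U a \<in> carrier_mat d d" "monomial ?T \<in> carrier_mat d d"
    using U_carrier[OF assms(1)] monomial_carrier[OF T(1)] by auto
  obtain \<epsilon> where \<epsilon>: "\<epsilon> \<in> {1, - 1}" "monomial S = \<epsilon> \<cdot>\<^sub>m (U a * monomial ?T)"
    using monomial_insert[OF assms(1) T(1)] T(2) by auto
  have "U a * monomial S = \<epsilon> \<cdot>\<^sub>m ((U a * U a) * monomial ?T)"
    using \<epsilon> c by (simp add: smult_simps assoc)
  then show ?thesis using \<epsilon>(1) c T(3) U_square[OF assms(1)] by auto
next
  case False
  then have T: "({a} - S) \<union> (S - {a}) = insert a S" by auto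
  obtain \<epsilon> where \<epsilon>: "\<epsilon> \<in> {1, - 1}" "monomial (insert a S) = \<epsilon> \<cdot>\<^sub>m (U a * monomial S)"
    using monomial_insert[OF assms False] by auto
  then have "\<epsilon> \<cdot>\<^sub>m monomial (insert a S) = U a * monomial S" by (auto simp: smult_simps)
  then show ?thesis using \<epsilon>(1) T by metis
qed

text \<open>The letters are absorbed one at a time, the last one first, each toggling its own
  membership. Distinctness matters: a repeated letter would toggle twice but count once in
  \<open>set xs\<close>.\<close>

lemma word_monomial:
  assumes "distinct xs" "set xs \<subseteq> I" "T \<subseteq> I"
  shows "\<exists>\<epsilon>\<in>{1, - 1}. word xs * monomial T = \<epsilon> \<cdot>\<^sub>m monomial ((set xs - T) \<union> (T - set xs))"
  using assms(1,2)
proof (induction xs)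
  case Nil
  then show ?case using monomial_carrier[OF assms(3)] by (auto simp: word_simps one_smult_mat)
next
  case (Cons a xs)
  let ?R = "(set xs - T) \<union> (T - set xs)"
  have c: "U a \<in> carrier_mat d d" "word xs \<in> carrier_mat d d" "monomial T \<in> carrier_mat d d"
    "a \<in> I" "?R \<subseteq> I"
    using Cons assms U_carrier word_carrier monomial_carrier by auto
  have cR: "monomial ?R \<in> carrier_mat d d" using c(5) by (rule monomial_carrier)
  obtain \<epsilon> where \<epsilon>: "\<epsilon> \<in> {1, - 1}" "word xs * monomial T = \<epsilon> \<cdot>\<^sub>m monomial ?R"
    using Cons by auto
  obtain \<delta> where \<delta>: "\<delta> \<in> {1, - 1}"
    "U a * monomial ?R = \<delta> \<cdot>\<^sub>m monomial (({a} - ?R) \<union> (?R - {a}))"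
    using generator_monomial[OF c(4,5)] by auto
  have "({a} - ?R) \<union> (?R - {a}) = (set (a # xs) - T) \<union> (T - set (a # xs))"
    using Cons.prems by auto
  moreover have "word (a # xs) * monomial T = (\<epsilon> * \<delta>) \<cdot>\<^sub>m monomial (({a} - ?R) \<union> (?R - {a}))"
    using c cR \<epsilon> \<delta> by (simp add: word_simps assoc smult_simps)
  ultimately show ?case using \<epsilon>(1) \<delta>(1) by (intro bexI[of _ "\<epsilon> * \<delta>"]) auto
qed

lemma monomial_mult:
  assumes "S \<subseteq> I" "T \<subseteq> I"
  shows "\<exists>\<epsilon>\<in>{1, - 1}. monomial S * monomial T = \<epsilon> \<cdot>\<^sub>m monomial ((S - T) \<union> (T - S))"
  using word_monomial[of "sorted_list_of_set S" T] assms finite_subset_I[OF assms(1)]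
  by (simp add: monomial_def[of S])

text \<open>The square of a monomial is a sign times the identity, because a set has empty symmetric
  difference with itself. Evaluating adjoint times square in two ways, once by this and once by
  unitarity, gives the claim.\<close>

lemma monomial_adjoint:
  assumes "S \<subseteq> I"
  shows "\<exists>\<epsilon>\<in>{1, - 1}. mat_adjoint (monomial S) = \<epsilon> \<cdot>\<^sub>m monomial S"
proof -
  have c: "monomial S \<in> carrier_mat d d" using assms by (rule monomial_carrier)
  obtain \<epsilon> where \<epsilon>: "\<epsilon> \<in> {1, - 1}" "monomial S * monomial S = \<epsilon> \<cdot>\<^sub>m 1\<^sub>m d"
    using monomial_mult[OF assms assms] by (auto simp: monomial_empty)
  have "mat_adjoint (monomial S) * (monomial S * monomial S) = \<epsilon> \<cdot>\<^sub>m mat_adjoint (monomial S)"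
    unfolding \<epsilon>(2) using c by (simp add: smult_simps)
  moreover have "mat_adjoint (monomial S) * (monomial S * monomial S) = monomial S"
    using c monomial_unitary[OF assms] by (simp add: assoc[symmetric])
  ultimately have "\<epsilon> \<cdot>\<^sub>m mat_adjoint (monomial S) = monomial S" by simp
  then have "\<epsilon> \<cdot>\<^sub>m monomial S = mat_adjoint (monomial S)"
    using \<epsilon>(1) by (metis (no_types, lifting) insertE mult_1 mult_minus1 minus_minus one_smult_mat singletonD smult_smult_mat)
  then show ?thesis using \<epsilon>(1) by metis
qed

section \<open>Trace orthogonality and conjugation of even monomials\<close>

lemma trace_monomial:
  assumes "S \<in> even_sets" "S \<noteq> {}"
  shows "mat_trace (monomial S) = 0"
proof -
  obtain a where a: "a \<in> S" using assms by auto
  have aI: "a \<in> I" and S: "S \<subseteq> I" using a assms by (auto simp: even_sets_def)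
  have c: "U a \<in> carrier_mat d d" "monomial S \<in> carrier_mat d d"
    using aI S U_carrier monomial_carrier by auto
  have "U a * monomial S * U a = (- 1) \<cdot>\<^sub>m (monomial S * (U a * U a))"
    using generator_even_monomial[OF aI assms(1)] a c by (simp add: smult_simps assoc)
  then have "(- 1) \<cdot>\<^sub>m monomial S = U a * monomial S * U a"
    using c U_square[OF aI] by simp
  then have "- mat_trace (monomial S) = mat_trace (U a * monomial S * U a)"
    using mat_trace_smult[OF c(2), of "- 1"] by simp
  also have "\<dots> = mat_trace (U a * (U a * monomial S))"
    using c by (intro mat_trace_mult_commute[of _ d d]) auto
  also have "U a * (U a * monomial S) = monomial S"
    using c U_square[OF aI] by (simp add: assoc[symmetric])
  finally show ?thesis by simp
qed

lemma hs_inner_monomial: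
  assumes "S \<in> even_sets" "T \<in> even_sets"
  shows "hs_inner (monomial S) (monomial T) = (if S = T then of_nat d else 0)"
proof (cases "S = T")
  case True
  have "mat_trace (1\<^sub>m d) = of_nat d" by (simp add: mat_trace_def)
  then show ?thesis
    using True assms monomial_unitary by (simp add: hs_inner_def even_sets_def)
next
  case False
  let ?R = "(S - T) \<union> (T - S)"
  have ST: "S \<subseteq> I" "T \<subseteq> I" using assms by (auto simp: even_sets_def)
  have R: "?R \<in> even_sets" "?R \<noteq> {}"
    using ST False assms finite_subset_I[OF ST(1)] finite_subset_I[OF ST(2)]
      card_symmetric_difference_even[of S T] by (auto simp: even_sets_def)
  have c: "monomial S \<in> carrier_mat d d" "monomial T \<in> carrier_mat d d"
    "monomial ?R \<in> carrier_mat d d"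
    using ST by (auto intro!: monomial_carrier)
  obtain \<epsilon> where \<epsilon>: "mat_adjoint (monomial S) = \<epsilon> \<cdot>\<^sub>m monomial S"
    using monomial_adjoint[OF ST(1)] by auto
  obtain \<delta> where \<delta>: "monomial S * monomial T = \<delta> \<cdot>\<^sub>m monomial ?R"
    using monomial_mult[OF ST] by auto
  have "mat_adjoint (monomial S) * monomial T = (\<epsilon> * \<delta>) \<cdot>\<^sub>m monomial ?R"
    using \<epsilon> \<delta> c by (simp add: smult_simps)
  then show ?thesis
    using trace_monomial[OF R] mat_trace_smult[OF c(3)] False by (simp add: hs_inner_def)
qed

lemma word_even_monomial:
  assumes "set xs \<subseteq> I" "S \<in> even_sets"
  shows "monomial S * word xs = (\<Prod>x\<leftarrow>xs. if x \<in> S then - 1 else 1) \<cdot>\<^sub>m (word xs * monomial S)"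
  using assms(1)
proof (induction xs)
  case Nil
  then show ?case using monomial_carrier[of S] assms by (simp add: word_simps one_smult_mat even_sets_def)
next
  case (Cons a xs)
  let ?s = "if a \<in> S then - 1 else 1 :: complex"
  let ?p = "\<Prod>x\<leftarrow>xs. if x \<in> S then - 1 else 1 :: complex"
  have a: "a \<in> I" using Cons by auto
  have c: "U a \<in> carrier_mat d d" "monomial S \<in> carrier_mat d d" "word xs \<in> carrier_mat d d"
    using Cons assms U_carrier word_carrier monomial_carrier by (auto simp: even_sets_def)
  have comm: "monomial S * U a = ?s \<cdot>\<^sub>m (U a * monomial S)"
    using generator_even_monomial[OF a assms(2)] c by (auto simp: smult_simps)
  have "monomial S * (U a * word xs) = monomial S * U a * word xs"
    using c by (simp add: assoc)
  also have "\<dots> = ?s \<cdot>\<^sub>m (U a * (monomial S * word xs))"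
    unfolding comm using c by (simp add: assoc smult_simps del: if_split)
  also have "monomial S * word xs = ?p \<cdot>\<^sub>m (word xs * monomial S)"
    using Cons by simp
  also have "?s \<cdot>\<^sub>m (U a * (?p \<cdot>\<^sub>m (word xs * monomial S))) = (?s * ?p) \<cdot>\<^sub>m (U a * word xs * monomial S)"
    using c by (simp add: smult_simps assoc del: if_split)
  finally show ?case by (simp add: word_simps del: if_split)
qed

text \<open>Precisely the generators indexed by both \<open>T\<close> and \<open>S\<close>
  anticommute with \<open>monomial S\<close>; \<open>T\<close> itself may have either parity. The
  adjoint stands on the left because \<open>hs_inner_mult_mult\<close> shifts the conjugation in
  \<Phi> to the test operator.\<close>

lemma monomial_conjugate:
  assumes "T \<subseteq> I" "S \<in> even_sets"
  shows "mat_adjoint (monomial T) * monomial S * monomial T = (- 1) ^ card (T \<inter> S) \<cdot>\<^sub>m monomial S"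
proof -
  have fin: "finite T" using finite_subset_I[OF assms(1)] .
  have c: "monomial S \<in> carrier_mat d d" "monomial T \<in> carrier_mat d d"
    using assms by (auto intro!: monomial_carrier simp: even_sets_def)
  have "(\<Prod>x\<leftarrow>sorted_list_of_set T. if x \<in> S then - 1 else 1 :: complex) =
      (\<Prod>x\<in>T. if x \<in> S then - 1 else 1)"
    using fin by (subst prod.distinct_set_conv_list[symmetric]) auto
  also have "\<dots> = (- 1) ^ card (T \<inter> S)"
    using fin by (simp add: prod.inter_restrict[symmetric])
  finally have "monomial S * monomial T = (- 1) ^ card (T \<inter> S) \<cdot>\<^sub>m (monomial T * monomial S)"
    using word_even_monomial[of "sorted_list_of_set T" S] assms fin by (simp add: monomial_def[of T])
  then have "mat_adjoint (monomial T) * monomial S * monomial T =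
      (- 1) ^ card (T \<inter> S) \<cdot>\<^sub>m (mat_adjoint (monomial T) * monomial T * monomial S)"
    using c by (simp add: assoc smult_simps)
  then show ?thesis using monomial_unitary[OF assms(1)] c by simp
qed

end

context clifford
begin

subsection \<open>Coordinate subspaces\<close>

definition unit_monomial :: "'a set \<Rightarrow> complex mat" where
  "unit_monomial S = complex_of_real (1 / sqrt d) \<cdot>\<^sub>m monomial S"

definition layer :: "nat \<Rightarrow> 'a set set" where
  "layer t = {S. S \<subseteq> I \<and> card S = 2 * t}"

definition low_layers :: "nat \<Rightarrow> 'a set set" where
  "low_layers t = {S \<in> even_sets. card S \<le> 2 * t}"

lemma even_sets_subset: "S \<in> even_sets \<Longrightarrow> S \<subseteq> I"
  by (simp add: even_sets_def)

lemma finite_even_sets: "finite even_sets"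
  using finite_I by (simp add: even_sets_def)

lemma card_even_sets: "card even_sets = d * d"
  using card_even_subsets[OF finite_I dim(1)] dim(2) by (simp add: even_sets_def)

lemma layer_even: "layer t \<subseteq> even_sets" and low_layers_even: "low_layers t \<subseteq> even_sets"
  by (auto simp: layer_def low_layers_def even_sets_def)

lemma even_monomial_carrier: "S \<in> even_sets \<Longrightarrow> monomial S \<in> carrier_mat d d"
  using monomial_carrier even_sets_subset by auto

lemma unit_monomial_carrier: "S \<in> even_sets \<Longrightarrow> unit_monomial S \<in> carrier_mat d d"
  using even_monomial_carrier by (simp add: unit_monomial_def)

lemma sqrt_d_square: "complex_of_real (1 / sqrt d) * complex_of_real (1 / sqrt d) = 1 / of_nat d"
proof -
  have "(1 / sqrt d) * (1 / sqrt d) = 1 / real d" by simp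
  then show ?thesis by (metis of_real_1 of_real_divide of_real_mult of_real_of_nat_eq)
qed

lemma unit_monomial_smult: "monomial S = complex_of_real (sqrt d) \<cdot>\<^sub>m unit_monomial S"
  using d_pos by (simp add: unit_monomial_def smult_smult_mat one_smult_mat flip: of_real_mult)

lemma hs_inner_unit_monomial:
  assumes "S \<in> even_sets" "T \<in> even_sets"
  shows "hs_inner (unit_monomial S) (unit_monomial T) = (if S = T then 1 else 0)"
proof -
  have "hs_inner (unit_monomial S) (unit_monomial T) =
      complex_of_real (1 / sqrt d) * complex_of_real (1 / sqrt d) * hs_inner (monomial S) (monomial T)"
    using assms even_monomial_carrier
    by (simp add: unit_monomial_def hs_inner_smult_left[of _ d] hs_inner_smult_right[of _ d])
  also have "\<dots> = (if S = T then 1 else 0)"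
    unfolding sqrt_d_square using hs_inner_monomial[OF assms] d_pos by simp
  finally show ?thesis .
qed

lemma inj_unit_monomial: "inj_on unit_monomial even_sets"
  by (rule inj_onI) (metis hs_inner_unit_monomial zero_neq_one)

lemma monomial_expansion:
  assumes "X \<in> carrier_mat d d"
  shows "X = (\<Oplus>\<^bsub>op_space d\<^esub>S\<in>even_sets. hs_inner (unit_monomial S) X \<cdot>\<^sub>m unit_monomial S)"
  using finite_even_sets card_even_sets unit_monomial_carrier hs_inner_unit_monomial assms
  by (rule orthonormal_complete_expansion)

lemma hs_inner_unit_eq_zero:
  assumes "S \<in> even_sets" "X \<in> carrier_mat d d"
  shows "hs_inner (unit_monomial S) X = 0 \<longleftrightarrow> hs_inner (monomial S) X = 0"
  using assms even_monomial_carrier[OF assms(1)] d_pos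
  by (simp add: unit_monomial_def hs_inner_smult_left[of _ d])

text \<open>The monomials are complete, so their inner products with an operator determine it. The
  relation between \<Phi> and the projections is verified through this test.\<close>

lemma eq_by_monomials:
  assumes "X \<in> carrier_mat d d" "Y \<in> carrier_mat d d"
    and "\<And>S. S \<in> even_sets \<Longrightarrow> hs_inner (monomial S) X = hs_inner (monomial S) Y"
  shows "X = Y"
proof -
  have "hs_inner (unit_monomial S) X = hs_inner (unit_monomial S) Y" if "S \<in> even_sets" for S
    using that assms even_monomial_carrier[OF that]
    by (simp add: unit_monomial_def hs_inner_smult_left[of _ d])
  then have "(\<Oplus>\<^bsub>op_space d\<^esub>S\<in>even_sets. hs_inner (unit_monomial S) X \<cdot>\<^sub>m unit_monomial S) =
      (\<Oplus>\<^bsub>op_space d\<^esub>S\<in>even_sets. hs_inner (unit_monomial S) Y \<cdot>\<^sub>m unit_monomial S)"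
    using finite_even_sets unit_monomial_carrier
    by (intro eq_matI)
      (auto simp: finsum_op_space_index carrier_matD[OF finsum_op_space_carrier] intro!: sum.cong)
  then show ?thesis
    using monomial_expansion[OF assms(1)] monomial_expansion[OF assms(2)] by simp
qed

definition coord_space :: "'a set set \<Rightarrow> complex mat set" where
  "coord_space A = op_span d (monomial ` A)"

lemma monomial_image_carrier: "A \<subseteq> even_sets \<Longrightarrow> monomial ` A \<subseteq> carrier_mat d d"
  and unit_monomial_image_carrier: "A \<subseteq> even_sets \<Longrightarrow> unit_monomial ` A \<subseteq> carrier_mat d d"
  using even_monomial_carrier unit_monomial_carrier by auto

lemma coord_space_carrier: "A \<subseteq> even_sets \<Longrightarrow> coord_space A \<subseteq> carrier_mat d d"
  unfolding coord_space_def by (intro op_span_carrier monomial_image_carrier)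

lemma monomial_in_coord_space: "A \<subseteq> even_sets \<Longrightarrow> S \<in> A \<Longrightarrow> monomial S \<in> coord_space A"
  unfolding coord_space_def by (intro op_span_base monomial_image_carrier) auto

lemma coord_space_unit:
  assumes "A \<subseteq> even_sets"
  shows "op_span d (unit_monomial ` A) = coord_space A"
proof
  note c = monomial_image_carrier[OF assms] and u = unit_monomial_image_carrier[OF assms]
  have "unit_monomial S \<in> coord_space A" if "S \<in> A" for S
    unfolding unit_monomial_def coord_space_def using c that by (intro op_span_smult op_span_base) auto
  then show "op_span d (unit_monomial ` A) \<subseteq> coord_space A"
    unfolding coord_space_def using c by (intro op_span_minimal) auto
  have "monomial S \<in> op_span d (unit_monomial ` A)" if "S \<in> A" for S
    unfolding unit_monomial_smult using u that by (intro op_span_smult op_span_base) auto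
  then show "coord_space A \<subseteq> op_span d (unit_monomial ` A)"
    unfolding coord_space_def using u by (intro op_span_minimal) auto
qed

lemma coord_space_onb:
  assumes "A \<subseteq> even_sets"
  shows "hs_orthonormal_basis d (coord_space A) (unit_monomial ` A)"
  unfolding hs_orthonormal_basis_def
proof (intro conjI ballI)
  show "finite (unit_monomial ` A)" using assms finite_even_sets finite_subset by auto
  show "unit_monomial ` A \<subseteq> coord_space A"
    unfolding coord_space_unit[OF assms, symmetric]
    using op_span_base[OF unit_monomial_image_carrier[OF assms]] by auto
  show "op_span d (unit_monomial ` A) = coord_space A" by (rule coord_space_unit[OF assms])
  fix E F assume "E \<in> unit_monomial ` A" "F \<in> unit_monomial ` A"
  then obtain S T where "S \<in> even_sets" "T \<in> even_sets" "E = unit_monomial S" "F = unit_monomial T"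
    using assms by auto
  then show "hs_inner E F = (if E = F then 1 else 0)"
    using inj_unit_monomial by (auto simp: hs_inner_unit_monomial inj_on_def)
qed

text \<open>Describing a span by vanishing coefficients turns questions about subspaces into set
  operations on the index families. The converse direction is where completeness enters.\<close>

lemma coord_space_iff:
  assumes "A \<subseteq> even_sets"
  shows "X \<in> coord_space A \<longleftrightarrow>
    X \<in> carrier_mat d d \<and> (\<forall>S\<in>even_sets - A. hs_inner (monomial S) X = 0)"
proof safe
  note c = monomial_image_carrier[OF assms]
  assume X: "X \<in> coord_space A"
  then show "X \<in> carrier_mat d d" using coord_space_carrier[OF assms] by auto
  fix S assume S: "S \<in> even_sets" "S \<notin> A"
  note Sc = even_monomial_carrier[OF S(1)]
  from c X[unfolded coord_space_def] show "hs_inner (monomial S) X = 0"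
  proof (induction rule: op_span_induct)
    case (base X)
    then show ?case using S assms hs_inner_monomial by auto
  qed (use Sc in \<open>auto simp: hs_inner_zero_right hs_inner_add_right[of _ d] hs_inner_smult_right[of _ d]\<close>)
next
  assume X: "X \<in> carrier_mat d d" and 0: "\<forall>S\<in>even_sets - A. hs_inner (monomial S) X = 0"
  note c = unit_monomial_image_carrier[OF assms]
  have "hs_inner (unit_monomial S) X \<cdot>\<^sub>m unit_monomial S \<in> op_span d (unit_monomial ` A)"
    if S: "S \<in> even_sets" for S
  proof (cases "S \<in> A")
    case True
    then show ?thesis using c by (auto intro: op_span_smult op_span_base)
  next
    case False
    then have "hs_inner (unit_monomial S) X = 0"
      using 0 S hs_inner_unit_eq_zero[OF S X] by auto
    moreover have "0 \<cdot>\<^sub>m unit_monomial S = 0\<^sub>m d d"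
      using unit_monomial_carrier[OF S] by (intro eq_matI) auto
    ultimately show ?thesis using op_span_zero[OF c] by simp
  qed
  then have "(\<Oplus>\<^bsub>op_space d\<^esub>S\<in>even_sets. hs_inner (unit_monomial S) X \<cdot>\<^sub>m unit_monomial S)
      \<in> op_span d (unit_monomial ` A)"
    using c finite_even_sets by (intro op_span_finsum) auto
  then show "X \<in> coord_space A"
    using monomial_expansion[OF X] coord_space_unit[OF assms] by simp
qed

lemma coord_space_orthogonal:
  assumes "B \<subseteq> even_sets"
  shows "X \<in> hs_orthogonal d (coord_space B) \<longleftrightarrow>
    X \<in> carrier_mat d d \<and> (\<forall>S\<in>B. hs_inner (monomial S) X = 0)"
proof safe
  assume "X \<in> hs_orthogonal d (coord_space B)"
  then show "X \<in> carrier_mat d d" "S \<in> B \<Longrightarrow> hs_inner (monomial S) X = 0" for S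
    using monomial_in_coord_space[OF assms] by (auto simp: hs_orthogonal_def)
next
  assume X: "X \<in> carrier_mat d d" and 0: "\<forall>S\<in>B. hs_inner (monomial S) X = 0"
  note c = monomial_image_carrier[OF assms]
  have "hs_inner X Y = 0" if "Y \<in> coord_space B" for Y
    using c that[unfolded coord_space_def]
  proof (induction rule: op_span_induct)
    case (base Y)
    then have "Y \<in> carrier_mat d d" "hs_inner Y X = 0" using c 0 by auto
    then show ?case using X hs_inner_commute[of Y d X] by simp
  qed (use X in \<open>auto simp: hs_inner_zero_right hs_inner_add_right[of _ d] hs_inner_smult_right[of _ d]\<close>)
  then have "hs_inner Y X = 0" if "Y \<in> coord_space B" for Y
    using that X hs_inner_commute[of X d Y] coord_space_carrier[OF assms] by auto
  then show "X \<in> hs_orthogonal d (coord_space B)" using X by (auto simp: hs_orthogonal_def)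
qed

text \<open>Both sides ask for coefficients to vanish: outside \<open>A\<close> for the span, on
  \<open>B\<close> for orthogonality.\<close>

lemma coord_space_Int_orthogonal:
  assumes "A \<subseteq> even_sets" "B \<subseteq> even_sets"
  shows "coord_space A \<inter> hs_orthogonal d (coord_space B) = coord_space (A - B)"
proof (rule Set.set_eqI)
  fix X
  have "A - B \<subseteq> even_sets" using assms by auto
  then show "X \<in> coord_space A \<inter> hs_orthogonal d (coord_space B) \<longleftrightarrow> X \<in> coord_space (A - B)"
    unfolding Int_iff coord_space_iff[OF assms(1)] coord_space_iff[OF \<open>A - B \<subseteq> even_sets\<close>]
      coord_space_orthogonal[OF assms(2)]
    using assms by blast
qed

lemma coord_space_full: "coord_space even_sets = carrier_mat d d"
  by (auto simp: coord_space_iff)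

lemma coord_space_proper:
  assumes "A \<subseteq> even_sets" "S \<in> even_sets" "S \<notin> A"
  shows "coord_space A \<noteq> carrier_mat d d"
  using assms even_monomial_carrier[OF assms(2)] d_pos hs_inner_monomial[OF assms(2,2)]
    coord_space_iff[OF assms(1), of "monomial S"] by auto

subsection \<open>The filtration generated by quadratic monomials\<close>

lemma monomial_pair:
  assumes "k \<in> I" "l \<in> I" "k < l"
  shows "monomial {k, l} = U k * U l"
proof -
  have "sorted_list_of_set {k, l} = [k, l]"
    using assms by (auto simp: sorted_list_of_set_insert)
  then show ?thesis using U_carrier[OF assms(2)] by (simp add: monomial_def word_simps)
qed

lemma low_layers_0: "low_layers 0 = {{}}"
  using finite_subset_I by (auto simp: low_layers_def even_sets_def)

text \<open>An even set of size at most two is empty or a pair, and the monomial of a pair is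
  \<open>U k * U l\<close> with no sign, so already the generating sets coincide.\<close>

lemma quadratic_span:
  "op_span d ({1\<^sub>m d} \<union> {U k * U l | k l. k \<in> I \<and> l \<in> I \<and> k < l}) = coord_space (low_layers 1)"
proof -
  have "{1\<^sub>m d} \<union> {U k * U l | k l. k \<in> I \<and> l \<in> I \<and> k < l} = monomial ` low_layers 1"
  proof (intro equalityI subsetI)
    fix X assume "X \<in> {1\<^sub>m d} \<union> {U k * U l | k l. k \<in> I \<and> l \<in> I \<and> k < l}"
    then consider "X = 1\<^sub>m d" | k l where "k \<in> I" "l \<in> I" "k < l" "X = U k * U l" by auto
    then show "X \<in> monomial ` low_layers 1"
    proof cases
      case 1
      then show ?thesis
        using monomial_empty by (intro image_eqI[of _ _ "{}"]) (auto simp: low_layers_def even_sets_def)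
    next
      case 2
      then show ?thesis
        using monomial_pair[of k l]
        by (intro image_eqI[of _ _ "{k, l}"]) (auto simp: low_layers_def even_sets_def)
    qed
  next
    fix X assume "X \<in> monomial ` low_layers 1"
    then obtain S where S: "S \<subseteq> I" "even (card S)" "card S \<le> 2" and X: "X = monomial S"
      by (auto simp: low_layers_def even_sets_def)
    then consider "card S = 0" | "card S = 2" by (cases "card S = 1") force+
    then show "X \<in> {1\<^sub>m d} \<union> {U k * U l | k l. k \<in> I \<and> l \<in> I \<and> k < l}"
    proof cases
      case 1
      then show ?thesis using X finite_subset_I[OF S(1)] monomial_empty by auto
    next
      case 2
      then obtain k l where "S = {k, l}" "k \<noteq> l" by (auto simp: card_2_iff)
      then obtain k l where "S = {k, l}" "k < l" by (metis insert_commute linorder_neqE)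
      then show ?thesis using X S monomial_pair[of k l] by auto
    qed
  qed
  then show ?thesis by (simp add: coord_space_def)
qed

text \<open>The symmetric difference of even sets is even and no larger than the two sizes together,
  so degrees add; the sign disappears in the span.\<close>

lemma coord_space_low_layers_mult:
  assumes "X \<in> coord_space (low_layers s)" "Y \<in> coord_space (low_layers t)"
  shows "X * Y \<in> coord_space (low_layers (s + t))"
  unfolding coord_space_def
proof (rule op_span_mult)
  let ?R = "\<lambda>S T. (S - T) \<union> (T - S)"
  fix X Y assume "X \<in> monomial ` low_layers s" "Y \<in> monomial ` low_layers t"
  then obtain S T where S: "S \<in> low_layers s" "X = monomial S" and T: "T \<in> low_layers t" "Y = monomial T"
    by auto
  then have ST: "S \<subseteq> I" "T \<subseteq> I" "finite S" "finite T"
    using finite_subset_I by (auto simp: low_layers_def even_sets_def)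
  have "card (?R S T) \<le> card S + card T"
    using ST by (metis (no_types, lifting) add_mono card_Diff_subset_Int card_Un_le diff_le_self finite_Int le_trans)
  then have "?R S T \<in> low_layers (s + t)"
    using S(1) T(1) ST card_symmetric_difference_even[of S T]
    by (auto simp: low_layers_def even_sets_def)
  then have "c \<cdot>\<^sub>m monomial (?R S T) \<in> op_span d (monomial ` low_layers (s + t))" for c
    by (intro op_span_smult op_span_base monomial_image_carrier low_layers_even) auto
  then show "X * Y \<in> op_span d (monomial ` low_layers (s + t))"
    using monomial_mult[OF ST(1,2)] S(2) T(2) by force
qed (use assms monomial_image_carrier[OF low_layers_even] in \<open>auto simp: coord_space_def\<close>)

text \<open>Each factor peels a pair of indices off \<open>S\<close>, which is possible because a
  nonempty even set has at least two elements.\<close>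

lemma low_layer_monomial_product:
  assumes "S \<in> low_layers m"
  shows "\<exists>As. length As = m \<and> set As \<subseteq> coord_space (low_layers 1) \<and>
    monomial S = foldr (*) As (1\<^sub>m d)"
  using assms
proof (induction m arbitrary: S)
  case 0
  then show ?case using low_layers_0 monomial_empty by auto
next
  case (Suc m)
  have S: "S \<subseteq> I" "even (card S)" "card S \<le> 2 * m + 2"
    using Suc by (auto simp: low_layers_def even_sets_def)
  note cs = monomial_in_coord_space[OF low_layers_even]
  show ?case
  proof (cases "S = {}")
    case True
    then have "S \<in> low_layers m" by (simp add: low_layers_def even_sets_def)
    then obtain As where As: "length As = m" "set As \<subseteq> coord_space (low_layers 1)"
      "monomial S = foldr (*) As (1\<^sub>m d)"
      using Suc.IH by blast
    \<comment> \<open>The list must have exactly \<open>Suc m\<close> factors, so with no pair left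
      to peel off it is padded with the identity.\<close>
    have "1\<^sub>m d \<in> coord_space (low_layers 1)"
      using cs[of "{}" 1] monomial_empty by (simp add: low_layers_def even_sets_def)
    then show ?thesis
      using As monomial_carrier[OF S(1)] by (intro exI[of _ "1\<^sub>m d # As"]) auto
  next
    case False
    have fS: "finite S" using finite_subset_I[OF S(1)] .
    then have "2 \<le> card S" using False S(2) by (cases "card S = 1") (auto simp: card_gt_0_iff Suc_le_eq elim!: evenE)
    then obtain P where P: "P \<subseteq> S" "card P = 2" by (meson obtain_subset_with_card_n)
    have "card (S - P) = card S - 2" using P fS by (metis card_Diff_subset finite_subset)
    then have SP: "S - P \<in> low_layers m" "P \<in> low_layers 1"
      using S P \<open>2 \<le> card S\<close> by (auto simp: low_layers_def even_sets_def)
    obtain As where As: "length As = m" "set As \<subseteq> coord_space (low_layers 1)"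
      "monomial (S - P) = foldr (*) As (1\<^sub>m d)"
      using Suc.IH[OF SP(1)] by blast
    have PI: "P \<subseteq> I" "S - P \<subseteq> I" using P S by auto
    have R: "(P - (S - P)) \<union> ((S - P) - P) = S" using P by auto
    obtain \<epsilon> where \<epsilon>: "\<epsilon> \<in> {1, - 1}" "monomial P * monomial (S - P) = \<epsilon> \<cdot>\<^sub>m monomial S"
      using monomial_mult[OF PI] unfolding R by auto
    have c: "monomial P \<in> carrier_mat d d" "monomial (S - P) \<in> carrier_mat d d"
      using PI monomial_carrier by auto
    \<comment> \<open>The sign is absorbed into the quadratic factor, which ranges over a linear
      space.\<close>
    have "(\<epsilon> \<cdot>\<^sub>m monomial P) * monomial (S - P) = (\<epsilon> * \<epsilon>) \<cdot>\<^sub>m monomial S"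
      using c \<epsilon>(2) by (simp add: smult_simps)
    also have "\<epsilon> * \<epsilon> = 1" using \<epsilon>(1) by auto
    finally have "monomial S = (\<epsilon> \<cdot>\<^sub>m monomial P) * monomial (S - P)" by (simp add: one_smult_mat)
    moreover have "\<epsilon> \<cdot>\<^sub>m monomial P \<in> coord_space (low_layers 1)"
      unfolding coord_space_def
      using SP(2) by (intro op_span_smult op_span_base monomial_image_carrier low_layers_even) auto
    ultimately show ?thesis
      using As by (intro exI[of _ "(\<epsilon> \<cdot>\<^sub>m monomial P) # As"]) auto
  qed
qed

lemma op_set_power_low_layers:
  "op_set_power d (coord_space (low_layers 1)) m = coord_space (low_layers m)"
proof
  let ?P = "{foldr (*) As (1\<^sub>m d) | As. length As = m \<and> set As \<subseteq> coord_space (low_layers 1)}"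
  have prod: "foldr (*) As (1\<^sub>m d) \<in> coord_space (low_layers (length As))"
    if "set As \<subseteq> coord_space (low_layers 1)" for As
    using that
  proof (induction As)
    case Nil
    then show ?case
      using monomial_in_coord_space[OF low_layers_even, of "{}" 0] low_layers_0 monomial_empty by simp
  next
    case (Cons A As)
    then show ?case using coord_space_low_layers_mult[of A 1] by simp
  qed
  then have P: "?P \<subseteq> coord_space (low_layers m)" by auto
  then show "op_set_power d (coord_space (low_layers 1)) m \<subseteq> coord_space (low_layers m)"
    unfolding op_set_power_def coord_space_def
    by (intro op_span_minimal monomial_image_carrier low_layers_even)
      (simp add: coord_space_def)
  have "monomial ` low_layers m \<subseteq> ?P"
    using low_layer_monomial_product by fastforce
  moreover have c: "?P \<subseteq> carrier_mat d d"
    using P coord_space_carrier[OF low_layers_even] by blast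
  ultimately have "monomial ` low_layers m \<subseteq> op_span d ?P"
    using op_span_base[OF c] by blast
  then show "coord_space (low_layers m) \<subseteq> op_set_power d (coord_space (low_layers 1)) m"
    unfolding op_set_power_def coord_space_def[of "low_layers m"]
    using c by (intro op_span_minimal)
qed

subsection \<open>Eigenvalues\<close>

text \<open>Tested against \<open>monomial S\<close>, each summand of \<Phi> contributes only its
  conjugation sign, so \<Phi> is diagonal in the monomials. The factor \<open>1 / of_nat d\<close>
  combines the two normalisations \<open>1 / sqrt d\<close>.\<close>

lemma hs_inner_Phi_map:
  assumes A: "A \<subseteq> even_sets" and S: "S \<in> even_sets" and X: "X \<in> carrier_mat d d"
  shows "hs_inner (monomial S) (Phi_map d (unit_monomial ` A) X) =
    1 / of_nat d * (\<Sum>T\<in>A. (- 1) ^ card (T \<inter> S)) * hs_inner (monomial S) X"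
proof -
  note c = even_monomial_carrier[OF S]
  have fin: "finite A" using A finite_even_sets finite_subset by auto
  have summand: "hs_inner (monomial S) (unit_monomial T * X * mat_adjoint (unit_monomial T)) =
      1 / of_nat d * (- 1) ^ card (T \<inter> S) * hs_inner (monomial S) X" if "T \<in> A" for T
  proof -
    let ?c = "complex_of_real (1 / sqrt d)"
    have T: "T \<in> even_sets" using that A by auto
    note cT = even_monomial_carrier[OF T] and uT = unit_monomial_carrier[OF T]
    have "mat_adjoint (unit_monomial T) * monomial S * unit_monomial T =
        (?c * ?c) \<cdot>\<^sub>m (mat_adjoint (monomial T) * monomial S * monomial T)"
      using c cT by (simp add: unit_monomial_def mat_adjoint_smult smult_simps)
    also have "\<dots> = (1 / of_nat d * (- 1) ^ card (T \<inter> S)) \<cdot>\<^sub>m monomial S"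
      unfolding monomial_conjugate[OF even_sets_subset[OF T] S] smult_smult_mat sqrt_d_square ..
    finally have eq: "mat_adjoint (unit_monomial T) * monomial S * unit_monomial T =
        (1 / of_nat d * (- 1) ^ card (T \<inter> S)) \<cdot>\<^sub>m monomial S" .
    have "hs_inner (monomial S) (unit_monomial T * X * mat_adjoint (unit_monomial T)) =
        hs_inner (mat_adjoint (unit_monomial T) * monomial S * mat_adjoint (mat_adjoint (unit_monomial T))) X"
      using c uT X by (intro hs_inner_mult_mult) auto
    then show ?thesis using eq c X by (simp add: hs_inner_smult_left[of _ d])
  qed
  have "hs_inner (monomial S) (Phi_map d (unit_monomial ` A) X) =
      (\<Sum>E\<in>unit_monomial ` A. hs_inner (monomial S) (E * X * mat_adjoint E))"
    unfolding Phi_map_def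
    using fin c X unit_monomial_image_carrier[OF A]
    by (intro hs_inner_finsum_right) (auto intro!: mult_carrier_mat[of _ d d])
  also have "\<dots> = (\<Sum>T\<in>A. hs_inner (monomial S) (unit_monomial T * X * mat_adjoint (unit_monomial T)))"
    using inj_on_subset[OF inj_unit_monomial A] by (simp add: sum.reindex)
  also have "\<dots> = (\<Sum>T\<in>A. 1 / of_nat d * (- 1) ^ card (T \<inter> S) * hs_inner (monomial S) X)"
    using summand by (intro sum.cong) auto
  finally show ?thesis by (simp add: sum_distrib_left sum_distrib_right)
qed

lemma hs_inner_Pi_map:
  assumes A: "A \<subseteq> even_sets" and S: "S \<in> even_sets" and X: "X \<in> carrier_mat d d"
  shows "hs_inner (monomial S) (Pi_map d (unit_monomial ` A) X) =
    (if S \<in> A then hs_inner (monomial S) X else 0)"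
proof -
  let ?c = "complex_of_real (1 / sqrt d)"
  note c = even_monomial_carrier[OF S]
  have fin: "finite A" using A finite_even_sets finite_subset by auto
  have "hs_inner (monomial S) (Pi_map d (unit_monomial ` A) X) =
      (\<Sum>E\<in>unit_monomial ` A. hs_inner (monomial S) (hs_inner E X \<cdot>\<^sub>m E))"
    unfolding Pi_map_def
    using fin c X unit_monomial_image_carrier[OF A] by (intro hs_inner_finsum_right) auto
  also have "\<dots> = (\<Sum>T\<in>A. hs_inner (monomial S) (hs_inner (unit_monomial T) X \<cdot>\<^sub>m unit_monomial T))"
    using inj_on_subset[OF inj_unit_monomial A] by (simp add: sum.reindex)
  also have "\<dots> = (\<Sum>T\<in>A. if S = T then hs_inner (monomial S) X else 0)"
  proof (intro sum.cong refl)
    fix T assume "T \<in> A"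
    then have T: "T \<in> even_sets" using A by auto
    note cT = even_monomial_carrier[OF T]
    have "hs_inner (monomial S) (hs_inner (unit_monomial T) X \<cdot>\<^sub>m unit_monomial T) =
        (?c * ?c) * hs_inner (monomial T) X * hs_inner (monomial S) (monomial T)"
      using c cT X by (simp add: unit_monomial_def hs_inner_smult_left[of _ d] hs_inner_smult_right[of _ d])
    then show "hs_inner (monomial S) (hs_inner (unit_monomial T) X \<cdot>\<^sub>m unit_monomial T) =
        (if S = T then hs_inner (monomial S) X else 0)"
      unfolding sqrt_d_square using hs_inner_monomial[OF S T] d_pos by auto
  qed
  also have "\<dots> = (if S \<in> A then hs_inner (monomial S) X else 0)"
    using fin by simp
  finally show ?thesis .
qed

text \<open>For 2j at most \<open>card I\<close> and up to the factor \<open>1 / real d\<close>,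
  this is the binary Krawtchouk polynomial of degree 2t and length \<open>card I\<close> at the
  point 2j: the coefficient of x^(2t) in (1 - x)^(2j) (1 + x)^(card I - 2j).\<close>

definition eigenvalue :: "nat \<Rightarrow> nat \<Rightarrow> real" where
  "eigenvalue t j = 1 / real d * (\<Sum>s = 0..2 * t. (- 1) ^ s * real ((2 * j) choose s) *
     real ((card I - 2 * j) choose (2 * t - s)))"

lemma hs_inner_Phi_map_layer:
  assumes S: "S \<in> layer j" and X: "X \<in> carrier_mat d d"
  shows "hs_inner (monomial S) (Phi_map d (unit_monomial ` layer t) X) =
    complex_of_real (eigenvalue t j) * hs_inner (monomial S) X"
proof -
  have "S \<subseteq> I" "card S = 2 * j" using S by (auto simp: layer_def)
  then have "(\<Sum>T\<in>layer t. (- 1) ^ card (T \<inter> S) :: complex) =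
      (\<Sum>s = 0..2 * t. (- 1) ^ s * of_nat ((2 * j) choose s) * of_nat ((card I - 2 * j) choose (2 * t - s)))"
    using sum_subsets_of_card_split[OF finite_I, where S = S and m = "2 * t" and g = "\<lambda>s. (- 1) ^ s :: complex"] by (simp add: layer_def)
  then show ?thesis
    using hs_inner_Phi_map[OF layer_even, of S X t] S X layer_even by (auto simp: eigenvalue_def)
qed

text \<open>A monomial is self-adjoint or anti-self-adjoint; in the second case a factor i repairs
  it. This supplies the test operators for uniqueness.\<close>

lemma self_adjoint_monomial:
  assumes "S \<subseteq> I"
  shows "\<exists>c. c \<noteq> 0 \<and> c \<cdot>\<^sub>m monomial S \<in> self_adjoint_ops d"
proof -
  have c: "monomial S \<in> carrier_mat d d" using assms by (rule monomial_carrier)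
  obtain \<epsilon> where \<epsilon>: "\<epsilon> \<in> {1, - 1}" "mat_adjoint (monomial S) = \<epsilon> \<cdot>\<^sub>m monomial S"
    using monomial_adjoint[OF assms] by auto
  let ?c = "if \<epsilon> = 1 then 1 else \<i>"
  have "mat_adjoint (?c \<cdot>\<^sub>m monomial S) = ?c \<cdot>\<^sub>m monomial S"
    using \<epsilon> by (auto simp: mat_adjoint_smult smult_smult_mat)
  then show ?thesis using c by (intro exI[of _ ?c]) (auto simp: self_adjoint_ops_def)
qed

text \<open>The equivalence delivers existence and uniqueness of the coefficients together. With
  \<open>card I = 2 * r + 1\<close> the layers 0 to \<open>r\<close> exhaust the even sets, which
  verifies the relation on all monomials, and none of them is empty, so each coefficient is
  determined.\<close>

lemma layer_decomposition_iff:
  assumes r: "card I = 2 * r + 1" and B: "\<And>j. j \<le> r \<Longrightarrow> hs_orthonormal_basis d (coord_space (layer j)) (B j)"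
  shows "(\<forall>t\<le>r. \<forall>X\<in>self_adjoint_ops d. Phi_map d (B t) X =
      (\<Oplus>\<^bsub>op_space d\<^esub>j\<in>{0..r}. complex_of_real (W t j) \<cdot>\<^sub>m Pi_map d (B j) X))
    \<longleftrightarrow> (\<forall>t\<le>r. \<forall>j\<le>r. W t j = eigenvalue t j)"
proof -
  let ?R = "\<lambda>t X. \<Oplus>\<^bsub>op_space d\<^esub>j\<in>{0..r}. complex_of_real (W t j) \<cdot>\<^sub>m Pi_map d (B j) X"
  note V = coord_space_carrier[OF layer_even]
  have Phi: "Phi_map d (B t) X = Phi_map d (unit_monomial ` layer t) X"
    and Pi: "Pi_map d (B t) X = Pi_map d (unit_monomial ` layer t) X"
    if "t \<le> r" "X \<in> carrier_mat d d" for t X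
    using onb_maps_unique[OF V B[OF that(1)] coord_space_onb[OF layer_even] that(2)] by auto
  have Pi_c: "Pi_map d (unit_monomial ` layer j) X \<in> carrier_mat d d" for j X
    by (rule Pi_map_carrier[OF unit_monomial_image_carrier[OF layer_even]])
  have Phi_c: "Phi_map d (unit_monomial ` layer j) X \<in> carrier_mat d d" if "X \<in> carrier_mat d d" for j X
    by (rule Phi_map_carrier[OF unit_monomial_image_carrier[OF layer_even] that])
  have R_c: "?R t X \<in> carrier_mat d d" if "X \<in> carrier_mat d d" for t X
    using that Pi Pi_c by (intro finsum_op_space_carrier) auto
  have R: "hs_inner (monomial S) (?R t X) = complex_of_real (W t j) * hs_inner (monomial S) X"
    if X: "X \<in> carrier_mat d d" and S: "S \<in> layer j" and j: "j \<le> r" for t j S X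
  proof -
    have Se: "S \<in> even_sets" using S layer_even by auto
    note c = even_monomial_carrier[OF Se]
    have "hs_inner (monomial S) (?R t X) =
        (\<Sum>i\<in>{0..r}. hs_inner (monomial S) (complex_of_real (W t i) \<cdot>\<^sub>m Pi_map d (B i) X))"
      using c X Pi Pi_c by (intro hs_inner_finsum_right) auto
    also have "\<dots> = (\<Sum>i\<in>{0..r}. if i = j then complex_of_real (W t j) * hs_inner (monomial S) X else 0)"
    proof (intro sum.cong refl)
      fix i assume "i \<in> {0..r}"
      \<comment> \<open>The layers are separated by cardinality, so a single projection sees
        \<open>S\<close>.\<close>
      moreover have "S \<in> layer i \<longleftrightarrow> i = j" using S by (auto simp: layer_def)
      ultimately show "hs_inner (monomial S) (complex_of_real (W t i) \<cdot>\<^sub>m Pi_map d (B i) X) =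
          (if i = j then complex_of_real (W t j) * hs_inner (monomial S) X else 0)"
        using hs_inner_Pi_map[OF layer_even Se X, of i]
        by (simp add: Pi X hs_inner_smult_right[OF c Pi_c])
    qed
    also have "\<dots> = complex_of_real (W t j) * hs_inner (monomial S) X" using j by simp
    finally show ?thesis .
  qed
  show ?thesis
  proof (intro iffI allI impI ballI)
    fix t X assume W: "\<forall>t\<le>r. \<forall>j\<le>r. W t j = eigenvalue t j" and t: "t \<le> r" and "X \<in> self_adjoint_ops d"
    then have X: "X \<in> carrier_mat d d" by (simp add: self_adjoint_ops_def)
    show "Phi_map d (B t) X = ?R t X"
      unfolding Phi[OF t X]
    proof (rule eq_by_monomials[OF Phi_c[OF X] R_c[OF X]])
      fix S assume S: "S \<in> even_sets"
      define j where "j = card S div 2"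
      have "card S \<le> card I" using S finite_I by (auto simp: even_sets_def intro: card_mono)
      then have "S \<in> layer j" "j \<le> r"
        using S r by (auto simp: even_sets_def layer_def j_def)
      then show "hs_inner (monomial S) (Phi_map d (unit_monomial ` layer t) X) =
          hs_inner (monomial S) (?R t X)"
        using W t X by (simp add: hs_inner_Phi_map_layer R)
    qed
  next
    fix t j assume eq: "\<forall>t\<le>r. \<forall>X\<in>self_adjoint_ops d. Phi_map d (B t) X = ?R t X"
      and t: "t \<le> r" and j: "j \<le> r"
    \<comment> \<open>Every layer up to \<open>r\<close> has a member, so no coefficient in range
      escapes the test.\<close>
    obtain S where S: "S \<subseteq> I" "card S = 2 * j"
      using obtain_subset_with_card_n[of "2 * j" I] j r by auto
    then have Sl: "S \<in> layer j" by (simp add: layer_def)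
    then have Se: "S \<in> even_sets" using layer_even by auto
    obtain c where c: "c \<noteq> 0" "c \<cdot>\<^sub>m monomial S \<in> self_adjoint_ops d"
      using self_adjoint_monomial[OF S(1)] by auto
    let ?X = "c \<cdot>\<^sub>m monomial S"
    have X: "?X \<in> carrier_mat d d" using c by (simp add: self_adjoint_ops_def)
    have "Phi_map d (unit_monomial ` layer t) ?X = ?R t ?X"
      using eq t c(2) Phi[OF t X] by simp
    then have "complex_of_real (eigenvalue t j) * hs_inner (monomial S) ?X =
        complex_of_real (W t j) * hs_inner (monomial S) ?X"
      using hs_inner_Phi_map_layer[OF Sl X, of t] R[OF X Sl j, of t] by metis
    moreover have "hs_inner (monomial S) ?X \<noteq> 0"
      using even_monomial_carrier[OF Se] hs_inner_monomial[OF Se Se] c(1) d_pos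
      by (simp add: hs_inner_smult_right[of _ d])
    ultimately show "W t j = eigenvalue t j" by simp
  qed
qed

end

section \<open>Kronecker products\<close>

lemma kron_dim [simp]:
  "dim_row (A \<otimes>\<^sub>K B) = dim_row A * dim_row B" "dim_col (A \<otimes>\<^sub>K B) = dim_col A * dim_col B"
  by (simp_all add: kron_def)

lemma kron_carrier:
  "A \<in> carrier_mat n m \<Longrightarrow> B \<in> carrier_mat k l \<Longrightarrow> A \<otimes>\<^sub>K B \<in> carrier_mat (n * k) (m * l)"
  unfolding carrier_mat_def by auto

lemma kron_index:
  "i < dim_row A * dim_row B \<Longrightarrow> j < dim_col A * dim_col B \<Longrightarrow>
    (A \<otimes>\<^sub>K B) $$ (i, j) = A $$ (i div dim_row B, j div dim_col B) * B $$ (i mod dim_row B, j mod dim_col B)"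
  by (simp add: kron_def)

lemma mod_less_of_less_mult: "(i::nat) < a * b \<Longrightarrow> i mod b < b"
  by (cases b) auto

text \<open>An index is a three-digit number in mixed radix, and both nestings read off the same
  digits; this is what \<open>div\<close>, \<open>mod\<close> and \<open>mix\<close>
  express.\<close>

lemma kron_assoc: "(A \<otimes>\<^sub>K B) \<otimes>\<^sub>K C = A \<otimes>\<^sub>K (B \<otimes>\<^sub>K C)"
proof (rule eq_matI)
  have div: "i div c div b = i div (b * c)" and mod: "i mod (b * c) mod c = i mod c"
    and mix: "i mod (b * c) div c = i div c mod b" for i b c :: nat
    by (simp_all add: div_mult2_eq mult.commute[of b] mod_mult2_eq mod_mod_cancel)
      (cases "c = 0"; simp add: mod_mult2_eq mult.commute[of b])
  fix i j assume "i < dim_row (A \<otimes>\<^sub>K (B \<otimes>\<^sub>K C))" "j < dim_col (A \<otimes>\<^sub>K (B \<otimes>\<^sub>K C))"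
  then have i: "i < dim_row A * dim_row B * dim_row C" and j: "j < dim_col A * dim_col B * dim_col C"
    by (simp_all add: mult.assoc)
  have "i div dim_row C < dim_row A * dim_row B" "j div dim_col C < dim_col A * dim_col B"
    "i mod (dim_row B * dim_row C) < dim_row B * dim_row C"
    "j mod (dim_col B * dim_col C) < dim_col B * dim_col C"
    using i j by (auto simp: less_mult_imp_div_less mult.assoc intro!: mod_less_of_less_mult)
  then show "((A \<otimes>\<^sub>K B) \<otimes>\<^sub>K C) $$ (i, j) = (A \<otimes>\<^sub>K (B \<otimes>\<^sub>K C)) $$ (i, j)"
    using i j by (simp add: kron_index div mod mix mult.assoc)
qed (simp_all add: mult.assoc)

lemma sum_div_mod:
  fixes f :: "nat \<Rightarrow> nat \<Rightarrow> 'a :: comm_monoid_add"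
  shows "(\<Sum>k = 0..<m * l. f (k div l) (k mod l)) = (\<Sum>p = 0..<m. \<Sum>q = 0..<l. f p q)"
proof -
  have "(\<Sum>k = 0..<m * l. f (k div l) (k mod l)) = (\<Sum>(p, q)\<in>{0..<m} \<times> {0..<l}. f p q)"
  proof (rule sum.reindex_bij_witness[where i = "\<lambda>(p, q). p * l + q" and j = "\<lambda>k. (k div l, k mod l)"])
    fix k assume "k \<in> {0..<m * l}"
    then show "(k div l, k mod l) \<in> {0..<m} \<times> {0..<l}"
      by (auto simp: less_mult_imp_div_less intro: mod_less_of_less_mult)
  next
    fix z assume "z \<in> {0..<m} \<times> {0..<l}"
    then obtain p q where z: "z = (p, q)" "p < m" "q < l" by auto
    have "p * l + q < Suc p * l" using z by simp
    also have "\<dots> \<le> m * l" using z by (intro mult_right_mono) auto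
    finally show "(case z of (p, q) \<Rightarrow> p * l + q) \<in> {0..<m * l}" using z by simp
  qed auto
  then show ?thesis by (simp add: sum.cartesian_product)
qed

text \<open>The contracted index is split into its two digits by \<open>sum_div_mod\<close>, after
  which the double sum factors.\<close>

lemma kron_mult:
  assumes "A \<in> carrier_mat n m" "B \<in> carrier_mat k l" "C \<in> carrier_mat m n'" "D \<in> carrier_mat l k'"
  shows "(A \<otimes>\<^sub>K B) * (C \<otimes>\<^sub>K D) = (A * C) \<otimes>\<^sub>K (B * D)"
proof (rule eq_matI)
  fix i j assume "i < dim_row ((A * C) \<otimes>\<^sub>K (B * D))" "j < dim_col ((A * C) \<otimes>\<^sub>K (B * D))"
  then have i: "i < n * k" and j: "j < n' * k'" using assms by auto
  then have b: "i div k < n" "i mod k < k" "j div k' < n'" "j mod k' < k'"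
    by (auto simp: less_mult_imp_div_less intro: mod_less_of_less_mult)
  have "((A \<otimes>\<^sub>K B) * (C \<otimes>\<^sub>K D)) $$ (i, j) =
      (\<Sum>r = 0..<m * l. A $$ (i div k, r div l) * B $$ (i mod k, r mod l) *
         (C $$ (r div l, j div k') * D $$ (r mod l, j mod k')))"
    using assms i j by (simp add: scalar_prod_def kron_index)
  also have "\<dots> = (\<Sum>p = 0..<m. \<Sum>q = 0..<l. A $$ (i div k, p) * B $$ (i mod k, q) *
         (C $$ (p, j div k') * D $$ (q, j mod k')))"
    by (rule sum_div_mod)
  also have "\<dots> = (\<Sum>p = 0..<m. A $$ (i div k, p) * C $$ (p, j div k')) *
      (\<Sum>q = 0..<l. B $$ (i mod k, q) * D $$ (q, j mod k'))"
    unfolding sum_product by (intro sum.cong refl) (simp add: mult_ac)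
  also have "\<dots> = ((A * C) \<otimes>\<^sub>K (B * D)) $$ (i, j)"
    using assms i j b by (simp add: scalar_prod_def kron_index)
  finally show "((A \<otimes>\<^sub>K B) * (C \<otimes>\<^sub>K D)) $$ (i, j) = ((A * C) \<otimes>\<^sub>K (B * D)) $$ (i, j)" .
qed (use assms in auto)

lemma kron_adjoint: "mat_adjoint (A \<otimes>\<^sub>K B) = mat_adjoint A \<otimes>\<^sub>K mat_adjoint B"
proof (rule eq_matI)
  fix i j assume "i < dim_row (mat_adjoint A \<otimes>\<^sub>K mat_adjoint B)" "j < dim_col (mat_adjoint A \<otimes>\<^sub>K mat_adjoint B)"
  then have "i < dim_col A * dim_col B" "j < dim_row A * dim_row B" by auto
  then show "mat_adjoint (A \<otimes>\<^sub>K B) $$ (i, j) = (mat_adjoint A \<otimes>\<^sub>K mat_adjoint B) $$ (i, j)"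
    by (simp add: mat_adjoint_index kron_index less_mult_imp_div_less mod_less_of_less_mult)
qed simp_all

lemma kron_smult_smult: "(a \<cdot>\<^sub>m A) \<otimes>\<^sub>K (b \<cdot>\<^sub>m B) = (a * b) \<cdot>\<^sub>m (A \<otimes>\<^sub>K B)"
  by (intro eq_matI) (auto simp: kron_index less_mult_imp_div_less mod_less_of_less_mult)

lemma one_kron: "1\<^sub>m 1 \<otimes>\<^sub>K A = A"
  by (intro eq_matI) (auto simp: kron_index)

lemma kron_one_one: "1\<^sub>m n \<otimes>\<^sub>K 1\<^sub>m m = 1\<^sub>m (n * m)"
proof (rule eq_matI)
  fix i j assume "i < dim_row (1\<^sub>m (n * m) :: complex mat)" "j < dim_col (1\<^sub>m (n * m) :: complex mat)"
  then have ij: "i < n * m" "j < n * m" by auto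
  have "i = j" if "i div m = j div m" "i mod m = j mod m"
    using that by (metis div_mult_mod_eq)
  then show "(1\<^sub>m n \<otimes>\<^sub>K 1\<^sub>m m) $$ (i, j) = 1\<^sub>m (n * m) $$ (i, j)"
    using ij by (auto simp: kron_index less_mult_imp_div_less mod_less_of_less_mult)
qed simp_all

text \<open>With a generator written as a list of 2 by 2 factors, products, adjoints and scalars can
  be computed one tensor position at a time.\<close>

primrec kron_list :: "complex mat list \<Rightarrow> complex mat" where
  "kron_list [] = 1\<^sub>m 1"
| "kron_list (A # As) = A \<otimes>\<^sub>K kron_list As"

lemma kron_list_append: "kron_list (As @ Bs) = kron_list As \<otimes>\<^sub>K kron_list Bs"
  by (induction As) (simp_all add: one_kron[unfolded One_nat_def] kron_assoc)

lemma kron_pow_kron_list: "kron_pow A k = kron_list (replicate k A)"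
  by (induction k) simp_all

lemma kron_list_carrier:
  "(\<And>x. x \<in> set xs \<Longrightarrow> f x \<in> carrier_mat 2 2) \<Longrightarrow>
    kron_list (map f xs) \<in> carrier_mat (2 ^ length xs) (2 ^ length xs)"
  by (induction xs) (simp_all add: kron_carrier)

lemma kron_list_mult:
  assumes "\<And>x. x \<in> set xs \<Longrightarrow> f x \<in> carrier_mat 2 2" "\<And>x. x \<in> set xs \<Longrightarrow> g x \<in> carrier_mat 2 2"
  shows "kron_list (map f xs) * kron_list (map g xs) = kron_list (map (\<lambda>x. f x * g x) xs)"
  using assms
proof (induction xs)
  case (Cons x xs)
  then show ?case
    using kron_mult[of "f x" 2 2 "kron_list (map f xs)" "2 ^ length xs" "2 ^ length xs"
        "g x" 2 "kron_list (map g xs)" "2 ^ length xs"]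
    by (simp add: kron_list_carrier)
qed simp

lemma kron_list_adjoint: "mat_adjoint (kron_list (map f xs)) = kron_list (map (\<lambda>x. mat_adjoint (f x)) xs)"
  by (induction xs) (simp_all add: kron_adjoint)

lemma kron_list_smult:
  "kron_list (map (\<lambda>x. c x \<cdot>\<^sub>m f x) xs) = (\<Prod>x\<leftarrow>xs. c x) \<cdot>\<^sub>m kron_list (map f xs)"
proof (induction xs)
  case Nil
  show ?case by (intro eq_matI) auto
qed (simp add: kron_smult_smult)

lemma kron_list_one: "kron_list (map (\<lambda>x. 1\<^sub>m 2) xs) = 1\<^sub>m (2 ^ length xs)"
  by (induction xs) (simp_all add: kron_one_one)

section \<open>The spinorial generators\<close>

lemma pauli_carrier:
  "sigma_x \<in> carrier_mat 2 2" "sigma_y \<in> carrier_mat 2 2" "sigma_z \<in> carrier_mat 2 2"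
  by (simp_all add: sigma_x_def sigma_y_def sigma_z_def mat_of_rows_list_def numeral_2_eq_2)

lemma eq_mat_2I:
  assumes "A \<in> carrier_mat 2 2" "B \<in> carrier_mat 2 2"
    "A $$ (0, 0) = B $$ (0, 0)" "A $$ (0, 1) = B $$ (0, 1)"
    "A $$ (1, 0) = B $$ (1, 0)" "A $$ (1, 1) = B $$ (1, 1)"
  shows "A = B"
  using assms by (intro eq_matI) (auto simp: less_2_cases_iff)

lemma sigma_index [simp]:
  "sigma_x $$ (0, 0) = 0" "sigma_x $$ (0, Suc 0) = 1" "sigma_x $$ (Suc 0, 0) = 1" "sigma_x $$ (Suc 0, Suc 0) = 0"
  "sigma_y $$ (0, 0) = 0" "sigma_y $$ (0, Suc 0) = - \<i>" "sigma_y $$ (Suc 0, 0) = \<i>" "sigma_y $$ (Suc 0, Suc 0) = 0"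
  "sigma_z $$ (0, 0) = 1" "sigma_z $$ (0, Suc 0) = 0" "sigma_z $$ (Suc 0, 0) = 0" "sigma_z $$ (Suc 0, Suc 0) = - 1"
  by (simp_all add: sigma_x_def sigma_y_def sigma_z_def mat_of_rows_list_def)

lemma mult_index_2:
  fixes A B :: "complex mat"
  assumes "A \<in> carrier_mat 2 2" "B \<in> carrier_mat 2 2" "i < 2" "j < 2"
  shows "(A * B) $$ (i, j) = A $$ (i, 0) * B $$ (0, j) + A $$ (i, 1) * B $$ (1, j)"
  using assms by (simp add: scalar_prod_def numeral_2_eq_2)

lemma pauli_adjoint:
  "mat_adjoint sigma_x = sigma_x" "mat_adjoint sigma_y = sigma_y" "mat_adjoint sigma_z = sigma_z"
  using pauli_carrier
  by (auto intro!: eq_mat_2I simp: mat_adjoint_index)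

lemma pauli_square:
  "sigma_x * sigma_x = 1\<^sub>m 2" "sigma_y * sigma_y = 1\<^sub>m 2" "sigma_z * sigma_z = 1\<^sub>m 2"
  using pauli_carrier
  by (auto intro!: eq_mat_2I mult_carrier_mat[of _ 2 2] simp: mult_index_2 simp del: index_mult_mat)

lemma pauli_anticommute:
  "sigma_x * sigma_y = (- 1) \<cdot>\<^sub>m (sigma_y * sigma_x)"
  "sigma_x * sigma_z = (- 1) \<cdot>\<^sub>m (sigma_z * sigma_x)"
  "sigma_y * sigma_z = (- 1) \<cdot>\<^sub>m (sigma_z * sigma_y)"
  using pauli_carrier
  by (auto intro!: eq_mat_2I smult_carrier_mat mult_carrier_mat[of _ 2 2] simp: mult_index_2 simp del: index_mult_mat(1))

text \<open>The position of the factor \<open>\<sigma>\<^sub>x\<close> or \<open>\<sigma>\<^sub>y\<close> in \<open>U\<^sub>k\<close>, counted from \<open>0\<close>; for \<open>k = 2n+1\<close> it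
  is \<open>n\<close>, beyond the last tensor factor.\<close>

definition spin_pos :: "nat \<Rightarrow> nat \<Rightarrow> nat" where
  "spin_pos n k = (if k \<le> n then k - 1 else if k \<le> 2 * n then k - n - 1 else n)"

text \<open>For \<open>k = 2 * n + 1\<close> the positions below \<open>n\<close> all fall under the
  first branch, so the last generator fits the same pattern as the others.\<close>

definition spin_factor :: "nat \<Rightarrow> nat \<Rightarrow> nat \<Rightarrow> complex mat" where
  "spin_factor n k i = (if i < spin_pos n k then sigma_z
     else if i = spin_pos n k then (if k \<le> n then sigma_x else sigma_y) else 1\<^sub>m 2)"

lemma spin_factor_carrier: "spin_factor n k i \<in> carrier_mat 2 2"
  by (simp add: spin_factor_def pauli_carrier)

text \<open>The tensor factors split at the distinguished position. The assumption excludes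
  \<open>k = 0\<close>, where truncated subtraction would produce \<open>n + 1\<close>
  factors.\<close>

lemma spin_U_kron_list:
  assumes "1 \<le> k"
  shows "spin_U n k = kron_list (map (spin_factor n k) [0..<n])"
proof -
  have single: "kron_list (map (spin_factor n k) [0..<n]) =
      kron_pow sigma_z p \<otimes>\<^sub>K P \<otimes>\<^sub>K kron_pow (1\<^sub>m 2) (n - Suc p)"
    if p: "p = spin_pos n k" "p < n" and P: "P = (if k \<le> n then sigma_x else sigma_y)" for p P
  proof -
    have "[0..<n] = [0..<p] @ p # [Suc p..<n]"
      using upt_add_eq_append[of 0 p "n - p"] upt_conv_Cons[OF p(2)] p(2) by simp
    moreover have "map (spin_factor n k) [0..<p] = replicate p sigma_z"
      by (rule nth_equalityI) (auto simp: spin_factor_def p(1))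
    moreover have "map (spin_factor n k) [Suc p..<n] = replicate (n - Suc p) (1\<^sub>m 2)"
      by (rule nth_equalityI) (auto simp: spin_factor_def p(1))
    moreover have "spin_factor n k p = P" by (simp add: spin_factor_def p(1) P)
    ultimately show ?thesis
      by (simp add: kron_list_append kron_pow_kron_list kron_assoc)
  qed
  consider "k \<le> n" | "n < k" "k \<le> 2 * n" | "2 * n < k" by linarith
  then show ?thesis
  proof cases
    case 1
    then show ?thesis using single[of "k - 1" sigma_x] assms by (simp add: spin_U_def spin_pos_def)
  next
    case 2
    then show ?thesis using single[of "k - n - 1" sigma_y]
      by (simp add: spin_U_def spin_pos_def Suc_diff_Suc)
  next
    case 3
    then have "map (spin_factor n k) [0..<n] = replicate n sigma_z"
      by (intro nth_equalityI) (auto simp: spin_factor_def spin_pos_def)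
    then show ?thesis using 3 by (simp add: spin_U_def kron_pow_kron_list)
  qed
qed

lemma spin_factor_adjoint: "mat_adjoint (spin_factor n k i) = spin_factor n k i"
  by (simp add: spin_factor_def pauli_adjoint)

lemma spin_factor_square: "spin_factor n k i * spin_factor n k i = 1\<^sub>m 2"
  by (simp add: spin_factor_def pauli_square)

text \<open>Two distinct generators have anticommuting factors in exactly one position, the first one
  where one of them carries \<open>\<sigma>\<^sub>x\<close> or \<open>\<sigma>\<^sub>y\<close>.\<close>

lemma spin_factor_commute:
  assumes "k \<noteq> l" "1 \<le> k" "1 \<le> l" "k \<le> 2 * n + 1" "l \<le> 2 * n + 1"
  shows "spin_factor n k i * spin_factor n l i =
    (if i = min (spin_pos n k) (spin_pos n l) then - 1 else 1) \<cdot>\<^sub>m (spin_factor n l i * spin_factor n k i)"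
proof -
  \<comment> \<open>Distinct generators share a position only as a \<sigma>x and \<sigma>y pair, and
    these anticommute.\<close>
  have same: "k \<le> n \<and> \<not> l \<le> n \<or> l \<le> n \<and> \<not> k \<le> n" if "spin_pos n k = spin_pos n l"
    using that assms by (auto simp: spin_pos_def split: if_splits)
  have neg: "B * A = (- 1) \<cdot>\<^sub>m (A * B)" if "A * B = (- 1) \<cdot>\<^sub>m (B * A)" for A B :: "complex mat"
    unfolding that by (intro eq_matI) auto
  note anti = pauli_anticommute pauli_anticommute[THEN neg]
  note c = pauli_carrier left_mult_one_mat[of _ 2 2] right_mult_one_mat[of _ 2 2]
  consider "spin_pos n k < spin_pos n l" | "spin_pos n l < spin_pos n k" | "spin_pos n k = spin_pos n l"
    by linarith
  then show ?thesis
  proof cases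
    case 3
    then show ?thesis using same[OF 3] by (auto simp: spin_factor_def one_smult_mat intro: anti)
  qed (auto simp: spin_factor_def one_smult_mat min_def c intro: anti)
qed

text \<open>Only the last generator has position \<open>n\<close>, so of two distinct generators at
  least one has its special factor inside the tensor product.\<close>

lemma spin_pos_min:
  assumes "k \<noteq> l" "1 \<le> k" "1 \<le> l" "k \<le> 2 * n + 1" "l \<le> 2 * n + 1"
  shows "min (spin_pos n k) (spin_pos n l) < n"
  using assms by (auto simp: spin_pos_def)

lemma spin_U_anticommute:
  assumes "k \<noteq> l" "1 \<le> k" "1 \<le> l" "k \<le> 2 * n + 1" "l \<le> 2 * n + 1"
  shows "spin_U n k * spin_U n l = (- 1) \<cdot>\<^sub>m (spin_U n l * spin_U n k)"
proof -
  let ?m = "min (spin_pos n k) (spin_pos n l)"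
  let ?s = "\<lambda>i. if i = ?m then - 1 else 1 :: complex"
  have "spin_U n k * spin_U n l = kron_list (map (\<lambda>i. spin_factor n k i * spin_factor n l i) [0..<n])"
    using assms by (simp add: spin_U_kron_list kron_list_mult spin_factor_carrier)
  also have "\<dots> = kron_list (map (\<lambda>i. ?s i \<cdot>\<^sub>m (spin_factor n l i * spin_factor n k i)) [0..<n])"
    using spin_factor_commute[OF assms] by simp
  also have "\<dots> = (\<Prod>i\<leftarrow>[0..<n]. ?s i) \<cdot>\<^sub>m
      kron_list (map (\<lambda>i. spin_factor n l i * spin_factor n k i) [0..<n])"
    by (rule kron_list_smult)
  also have "(\<Prod>i\<leftarrow>[0..<n]. ?s i) = (\<Prod>i\<in>{0..<n}. ?s i)"
    by (subst prod.distinct_set_conv_list[symmetric]) auto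
  also have "\<dots> = - 1"
    using spin_pos_min[OF assms] by (subst prod.delta) auto
  also have "kron_list (map (\<lambda>i. spin_factor n l i * spin_factor n k i) [0..<n]) = spin_U n l * spin_U n k"
    using assms by (simp add: spin_U_kron_list kron_list_mult spin_factor_carrier)
  finally show ?thesis .
qed

lemma spin_U_carrier: "1 \<le> k \<Longrightarrow> spin_U n k \<in> carrier_mat (2 ^ n) (2 ^ n)"
  using kron_list_carrier[of "[0..<n]" "spin_factor n k"]
  by (simp add: spin_U_kron_list spin_factor_carrier)

lemma spin_U_adjoint: "1 \<le> k \<Longrightarrow> mat_adjoint (spin_U n k) = spin_U n k"
  by (simp add: spin_U_kron_list kron_list_adjoint spin_factor_adjoint)

lemma spin_U_square: "1 \<le> k \<Longrightarrow> spin_U n k * spin_U n k = 1\<^sub>m (2 ^ n)"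
  using kron_list_one[of "[0..<n]"]
  by (simp add: spin_U_kron_list kron_list_mult spin_factor_carrier spin_factor_square)

section \<open>The spinorial metric\<close>

lemma clifford_spin_U: "clifford (2 ^ n) {Suc 0..Suc (2 * n)} (spin_U n)"
proof
  show "2 * (2 ^ n * 2 ^ n) = (2 :: nat) ^ card {Suc 0..Suc (2 * n)}"
    by (simp add: power_add[symmetric] mult_2)
qed (auto intro!: spin_U_carrier spin_U_adjoint spin_U_square spin_U_anticommute)

interpretation spin: clifford "2 ^ n" "{Suc 0..Suc (2 * n)}" "spin_U n" for n
  by (rule clifford_spin_U)

lemma spin_E_eq: "spin_E n = spin.coord_space n (spin.low_layers n 1)"
proof -
  have "{spin_U n k * spin_U n l | k l. 1 \<le> k \<and> k < l \<and> l \<le> 2 * n + 1} =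
      {spin_U n k * spin_U n l | k l. k \<in> {Suc 0..Suc (2 * n)} \<and> l \<in> {Suc 0..Suc (2 * n)} \<and> k < l}"
    by (intro Collect_cong ex_cong1) auto
  then show ?thesis
    unfolding spin_E_def spin.quadratic_span[of n, symmetric] by simp
qed

lemma spin_metric_eq: "spin_metric n t = spin.coord_space n (spin.low_layers n (nat \<lfloor>t\<rfloor>))"
proof (cases "t < 1")
  case True
  \<comment> \<open>For negative \<open>t\<close> as well \<open>nat\<close> returns 0, so one
    formula covers both branches of the metric.\<close>
  then have "nat \<lfloor>t\<rfloor> = 0" by linarith
  then show ?thesis
    using True by (simp add: spin_metric_def spin.low_layers_0 spin.coord_space_def spin.monomial_empty)
next
  case False
  then show ?thesis
    by (simp add: spin_metric_def spin_E_eq spin.op_set_power_low_layers del: One_nat_def)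
qed

section \<open>Diameter and layers of the spinorial metric\<close>

lemma spin_metric_full_iff:
  "spin_metric n t = carrier_mat (2 ^ n) (2 ^ n) \<longleftrightarrow> n \<le> nat \<lfloor>t\<rfloor>"
proof
  assume "n \<le> nat \<lfloor>t\<rfloor>"
  moreover have "card S \<le> 2 * n" if "S \<in> spin.even_sets n" for S
  proof -
    \<comment> \<open>The number of generators is odd, so an even set omits at least one of
      them.\<close>
    have "card S \<le> Suc (2 * n)" "even (card S)"
      using that card_mono[of "{Suc 0..Suc (2 * n)}" S] by (auto simp: spin.even_sets_def)
    then show ?thesis by (metis even_Suc even_mult_iff even_numeral le_Suc_eq)
  qed
  ultimately have "\<forall>S\<in>spin.even_sets n. card S \<le> 2 * nat \<lfloor>t\<rfloor>"
    by (meson mult_le_mono2 order_trans)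
  then have "spin.low_layers n (nat \<lfloor>t\<rfloor>) = spin.even_sets n"
    unfolding spin.low_layers_def by auto
  then show "spin_metric n t = carrier_mat (2 ^ n) (2 ^ n)"
    by (simp add: spin_metric_eq spin.coord_space_full)
next
  assume full: "spin_metric n t = carrier_mat (2 ^ n) (2 ^ n)"
  show "n \<le> nat \<lfloor>t\<rfloor>"
  proof (rule ccontr)
    assume "\<not> n \<le> nat \<lfloor>t\<rfloor>"
    \<comment> \<open>An even set of the largest possible size, whose monomial is therefore the last
      to appear in the filtration.\<close>
    then have "{1..2 * n} \<in> spin.even_sets n" "{1..2 * n} \<notin> spin.low_layers n (nat \<lfloor>t\<rfloor>)"
      by (auto simp: spin.even_sets_def spin.low_layers_def)
    then show False
      using spin.coord_space_proper[OF spin.low_layers_even] full by (auto simp: spin_metric_eq)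
  qed
qed

lemma qm_diameter_spin_metric: "qm_diameter (2 ^ n) (spin_metric n) = real n"
  unfolding qm_diameter_def spin_metric_full_iff
  by (rule Least_equality) linarith+

lemma qm_layer_spin_metric:
  "qm_layer (2 ^ n) (spin_metric n) t = spin.coord_space n (spin.layer n t)"
proof (cases t)
  case 0
  have "spin.layer n 0 = {{}}"
    using spin.finite_subset_I by (auto simp: spin.layer_def)
  then show ?thesis
    using 0 by (simp add: qm_layer_def spin.coord_space_def spin.monomial_empty)
next
  case (Suc m)
  \<comment> \<open>Parity excludes the size 2m + 1, so passing from level m to m + 1 adds a single
    cardinality.\<close>
  have "even k \<and> k \<le> 2 * Suc m \<and> \<not> k \<le> 2 * m \<longleftrightarrow> k = 2 * Suc m" for k :: nat
    by presburger
  then have "spin.low_layers n (Suc m) - spin.low_layers n m = spin.layer n (Suc m)"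
    unfolding spin.low_layers_def spin.layer_def spin.even_sets_def by blast
  moreover have "nat \<lfloor>real (Suc m)\<rfloor> = Suc m" "nat \<lfloor>real (Suc m) - 1\<rfloor> = m" by linarith+
  ultimately show ?thesis
    using Suc spin.coord_space_Int_orthogonal[OF spin.low_layers_even spin.low_layers_even, of n "Suc m" m]
    by (simp add: qm_layer_def spin_metric_eq)
qed

lemma is_W_family_spin_metric_iff:
  "is_W_family (2 ^ n) (spin_metric n) W \<longleftrightarrow> (\<forall>t\<le>n. \<forall>j\<le>n. W t j = spin.eigenvalue n t j)"
proof -
  have iff: "(\<forall>t\<le>n. \<forall>X\<in>self_adjoint_ops (2 ^ n). Phi_map (2 ^ n) (B t) X =
      (\<Oplus>\<^bsub>op_space (2 ^ n)\<^esub>j\<in>{0..n}. complex_of_real (W t j) \<cdot>\<^sub>m Pi_map (2 ^ n) (B j) X))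
      \<longleftrightarrow> (\<forall>t\<le>n. \<forall>j\<le>n. W t j = spin.eigenvalue n t j)"
    if "\<forall>j\<le>n. hs_orthonormal_basis (2 ^ n) (qm_layer (2 ^ n) (spin_metric n) j) (B j)" for B
    using that by (intro spin.layer_decomposition_iff) (auto simp: qm_layer_spin_metric)
  \<comment> \<open>Some choice of bases must exist: otherwise the quantifier over \<open>B\<close>
    in \<open>is_W_family\<close> would be vacuous and would leave \<open>W\<close>
    undetermined.\<close>
  have "\<forall>j\<le>n. hs_orthonormal_basis (2 ^ n) (qm_layer (2 ^ n) (spin_metric n) j)
      (spin.unit_monomial n ` spin.layer n j)"
    using spin.coord_space_onb[OF spin.layer_even] by (simp add: qm_layer_spin_metric)
  then show ?thesis
    unfolding is_W_family_def qm_diameter_spin_metric Let_def using iff by auto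
qed

theorem proposition3p6p4:
  fixes n t j :: nat
  assumes "n \<ge> 1" and "t \<le> n" and "j \<le> n"
  shows "W_coeff (2 ^ n) (spin_metric n) t j =
    1 / 2 ^ n * (\<Sum>s = 0..2 * t. (- 1) ^ s * real ((2 * j) choose s) *
      real ((2 * n + 1 - 2 * j) choose (2 * t - s)))"
proof -
  have "W_coeff (2 ^ n) (spin_metric n) t j = spin.eigenvalue n t j"
    unfolding W_coeff_def is_W_family_spin_metric_iff
  proof (rule the_equality)
    \<comment> \<open>The eigenvalues themselves form a family. Families are free beyond index
      \<open>n\<close>, so uniqueness at this pair relies on \<open>t \<le> n\<close> and
      \<open>j \<le> n\<close>.\<close>
    show "\<exists>W. (\<forall>t\<le>n. \<forall>j\<le>n. W t j = spin.eigenvalue n t j) \<and> W t j = spin.eigenvalue n t j"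
      by (rule exI[of _ "spin.eigenvalue n"]) simp
  qed (use assms in auto)
  then show ?thesis by (simp add: spin.eigenvalue_def)
qed

end
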